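(* Let $n\geq3$, let $f:(\mathbb K^{n-2},S)\to(\mathbb K^{n-2},0)$ be a (multi)germ of minimal corank, let $F(x,\lambda)=(f_\lambda(x),\lambda)$, $\lambda\in\mathbb K^2$, be a 2-parameter stable unfolding of $f$, and let $g(x_1,\ldots,x_{n-2},y,z)=(x_1,\ldots,x_{n-2},y,z^3+yz)$, so that $\{F,g\}$ is the cuspidal concatenation of $f$. Then $$\mathcal A_e\text{-}\mathrm{cod}(\{F,g\})=\dim_{\mathbb K}\frac{\mathcal O_{n-1}}{\{\xi:\ \xi=-z\,\eta_{n-1}(x,-3z^2,-2z^3)+\eta_n(x,-3z^2,-2z^3)\}},$$ where $\mathcal O_{n-1}$ is the ring of function germs in the variables $(x,z)=(x_1,\ldots,x_{n-2},z)$ and $(\eta_{n-1},\eta_n)$ ranges over the last two components of the vector fields $\eta=(\eta_1,\ldots,\eta_n)\in\mathrm{Lift}(F)$.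
   Context: $\mathbb K=\mathbb C$ or $\mathbb R$. A multigerm $f:(\mathbb K^n,S)\to(\mathbb K^p,0)$ is the germ along a finite set $S$ of an analytic (if $\mathbb K=\mathbb C$) or smooth (if $\mathbb K=\mathbb R$) map; $\{F,g\}$ is the multigerm whose branches are those of $F$ together with those of $g$. $\theta_n,\theta_p$ are germs of vector fields on source and target, $\theta(f)$ germs of vector fields along $f$, and $\mathcal A_e\text{-}\mathrm{cod}(f)=\dim_{\mathbb K}\theta(f)/(\{df\circ\xi:\xi\in\theta_n\}+\{\eta\circ f:\eta\in\theta_p\})$; $f$ is stable if this is $0$. $\mathrm{Lift}(f)=\{\eta\in\theta_p:\exists\,\xi\in\theta_n,\ df\circ\xi=\eta\circ f\}$. Minimal corank: every branch has differential of rank at least the minimum of source and target dimensions minus 1. A 2-parameter stable unfolding of $f$ is $F(x,\lambda)=(f_\lambda(x),\lambda)$, $\lambda\in\mathbb K^2$, $f_0=f$, with $F:(\mathbb K^n,S\times\{0\})\to(\mathbb K^n,0)$ stable. Target coordinates of $F$ and $g$ are $(X_1,\ldots,X_{n-2},Y,Z)$, the last two being the unfolding parameters of $F$. *)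

theory Defs
  imports "HOL-Analysis.Analysis" "HOL-Library.Function_Algebras"
begin

section \<open>Dimension of a quotient of vector spaces\<close>

definition basis_modulo ::
  "('k::field \<Rightarrow> 'v::ab_group_add \<Rightarrow> 'v) \<Rightarrow> 'v set \<Rightarrow> 'v set \<Rightarrow> 'v set \<Rightarrow> bool" where
  "basis_modulo sc V W B \<longleftrightarrow>
     B \<subseteq> V \<and>
     (\<forall>v\<in>V. \<exists>c. v - (\<Sum>b\<in>B. sc (c b) b) \<in> W) \<and>
     (\<forall>c. (\<Sum>b\<in>B. sc (c b) b) \<in> W \<longrightarrow> (\<forall>b\<in>B. c b = 0))"

text \<open>All finite bases of \<open>V/W\<close> have the same cardinality, so the infimum just picks the common
  value; if there is no finite basis it is the infimum of the empty set, namely \<open>\<infinity>\<close>.\<close>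

definition quotient_dim ::
  "('k::field \<Rightarrow> 'v::ab_group_add \<Rightarrow> 'v) \<Rightarrow> 'v set \<Rightarrow> 'v set \<Rightarrow> enat" where
  "quotient_dim sc V W = (INF B\<in>{B. finite B \<and> basis_modulo sc V W B}. enat (card B))"


section \<open>Smooth and analytic function germs\<close>

text \<open>The class \<open>C\<^sup>k\<close> on an open subset \<open>U\<close> of a finite-dimensional space; there, \<open>C\<^sup>k\<close> dependence of
  the differential is the same as \<open>C\<^sup>k\<close> dependence of all its values.\<close>

primrec C_differentiable_on ::
  "nat \<Rightarrow> ('a::real_normed_vector \<Rightarrow> 'b::real_normed_vector) \<Rightarrow> 'a set \<Rightarrow> bool" where
  "C_differentiable_on 0 h U \<longleftrightarrow> continuous_on U h"
| "C_differentiable_on (Suc k) h U \<longleftrightarrow>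
     (\<forall>x\<in>U. h differentiable (at x)) \<and>
     (\<forall>v. C_differentiable_on k (\<lambda>x. frechet_derivative h (at x) v) U)"

definition smooth_on :: "('a::real_normed_vector \<Rightarrow> 'b::real_normed_vector) \<Rightarrow> 'a set \<Rightarrow> bool" where
  "smooth_on h U \<longleftrightarrow> (\<forall>k. C_differentiable_on k h U)"

text \<open>For \<open>'k = complex\<close> this is holomorphy in several variables: the Frechet derivative exists
  everywhere on \<open>U\<close> and is \<open>'k\<close>-linear.\<close>

definition multi_holomorphic_on :: "('k::real_normed_field^'n \<Rightarrow> 'k) \<Rightarrow> ('k^'n) set \<Rightarrow> bool" where
  "multi_holomorphic_on h U \<longleftrightarrow>
     (\<forall>x\<in>U. \<exists>a::'k^'n. (h has_derivative (\<lambda>v. \<Sum>i\<in>UNIV. a $ i * v $ i)) (at x))"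

text \<open>The two ground fields are told apart by whether \<open>-1\<close> is a square. As with
  \<^const>\<open>analytic_on\<close>, analytic at a point means holomorphic near that point.\<close>

definition regular_at :: "('k::real_normed_field^'n \<Rightarrow> 'k) \<Rightarrow> 'k^'n \<Rightarrow> bool" where
  "regular_at h a \<longleftrightarrow>
     (\<exists>U. open U \<and> a \<in> U \<and>
          (if \<exists>j::'k. j\<^sup>2 = -1 then multi_holomorphic_on h U else smooth_on h U))"

lemma regular_at_real:
  fixes h :: "real^'n \<Rightarrow> real"
  shows "regular_at h a \<longleftrightarrow> (\<exists>U. open U \<and> a \<in> U \<and> smooth_on h U)"
proof -
  have "j\<^sup>2 \<noteq> -1" for j :: real
    using zero_le_power2[of j] by linarith
  then show ?thesis
    by (simp add: regular_at_def)
qed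

lemma regular_at_complex:
  fixes h :: "complex^'n \<Rightarrow> complex"
  shows "regular_at h a \<longleftrightarrow> (\<exists>U. open U \<and> a \<in> U \<and> multi_holomorphic_on h U)"
proof -
  have "\<exists>j::complex. j\<^sup>2 = -1"
    using power2_i by blast
  then show ?thesis
    by (simp add: regular_at_def)
qed

definition map_regular_at :: "('k::real_normed_field^'n \<Rightarrow> 'k^'p) \<Rightarrow> 'k^'n \<Rightarrow> bool" where
  "map_regular_at \<phi> a \<longleftrightarrow> (\<forall>j. regular_at (\<lambda>x. \<phi> x $ j) a)"


section \<open>Multigerms\<close>

text \<open>A multigerm is given by a finite family of branches, each a map considered near its base point.
  A family, rather than one map near a set of points, is needed for \<open>{F,g}\<close>, whose source is a
  disjoint union of germs of spaces: the base point of \<open>g\<close> may also be a base point of \<open>F\<close>.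

  Germs are represented by functions, and two of them are identified if they agree near the
  base point.  The subspaces divided out below are closed under this identification and contain
  the functions with zero germ, so quotients of spaces of representatives are the
  quotients of the spaces of germs.\<close>

record ('i, 'k, 'n, 'p) multigerm =
  branches :: "'i set"
  base_point :: "'i \<Rightarrow> 'k^'n"
  branch_map :: "'i \<Rightarrow> 'k^'n \<Rightarrow> 'k^'p"

definition is_multigerm ::
  "('i, 'k::real_normed_field, 'n::finite, 'p::finite) multigerm \<Rightarrow> bool" where
  "is_multigerm f \<longleftrightarrow> finite (branches f) \<and>
     (\<forall>i\<in>branches f. map_regular_at (branch_map f i) (base_point f i) \<and>
                     branch_map f i (base_point f i) = 0)"

definition germ_along ::
  "('k::real_normed_field^'n) set \<Rightarrow> ('k^'n \<Rightarrow> 'k^'p) \<Rightarrow> ('k^'n, 'k, 'n::finite, 'p::finite) multigerm"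
  where
  "germ_along S f = \<lparr>branches = S, base_point = (\<lambda>s. s), branch_map = (\<lambda>s. f)\<rparr>"

definition join_germs ::
  "('i, 'k::real_normed_field, 'n::finite, 'p::finite) multigerm \<Rightarrow> ('j, 'k, 'n, 'p) multigerm \<Rightarrow>
   ('i + 'j, 'k, 'n, 'p) multigerm" where
  "join_germs f g =
     \<lparr>branches = branches f <+> branches g,
      base_point = case_sum (base_point f) (base_point g),
      branch_map = case_sum (branch_map f) (branch_map g)\<rparr>"

definition theta_source ::
  "('i, 'k::real_normed_field, 'n::finite, 'p::finite) multigerm \<Rightarrow> ('i \<Rightarrow> 'k^'n \<Rightarrow> 'k^'n) set" where
  "theta_source f = {\<xi>. \<forall>i\<in>branches f. map_regular_at (\<xi> i) (base_point f i)}"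

definition theta_target :: "('k::real_normed_field^'p \<Rightarrow> 'k^'p) set" where
  "theta_target = {\<eta>. map_regular_at \<eta> 0}"

definition theta ::
  "('i, 'k::real_normed_field, 'n::finite, 'p::finite) multigerm \<Rightarrow> ('i \<Rightarrow> 'k^'n \<Rightarrow> 'k^'p) set" where
  "theta f = {v. \<forall>i\<in>branches f. map_regular_at (v i) (base_point f i)}"

definition extended_tangent_space ::
  "('i, 'k::real_normed_field, 'n::finite, 'p::finite) multigerm \<Rightarrow> ('i \<Rightarrow> 'k^'n \<Rightarrow> 'k^'p) set" where
  "extended_tangent_space f =
     {v \<in> theta f. \<exists>\<xi>\<in>theta_source f. \<exists>\<eta>\<in>theta_target. \<forall>i\<in>branches f.
        \<forall>\<^sub>F x in nhds (base_point f i).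
          v i x = frechet_derivative (branch_map f i) (at x) (\<xi> i x) + \<eta> (branch_map f i x)}"

definition Ae_cod :: "('i, 'k::real_normed_field, 'n::finite, 'p::finite) multigerm \<Rightarrow> enat" where
  "Ae_cod f = quotient_dim (\<lambda>c v i x. c *s v i x) (theta f) (extended_tangent_space f)"

definition stable :: "('i, 'k::real_normed_field, 'n::finite, 'p::finite) multigerm \<Rightarrow> bool" where
  "stable f \<longleftrightarrow> Ae_cod f = 0"

definition Lift ::
  "('i, 'k::real_normed_field, 'n::finite, 'p::finite) multigerm \<Rightarrow> ('k^'p \<Rightarrow> 'k^'p) set" where
  "Lift f =
     {\<eta> \<in> theta_target. \<exists>\<xi>\<in>theta_source f. \<forall>i\<in>branches f.
        \<forall>\<^sub>F x in nhds (base_point f i).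
          frechet_derivative (branch_map f i) (at x) (\<xi> i x) = \<eta> (branch_map f i x)}"

definition minimal_corank ::
  "('i, 'k::real_normed_field, 'n::finite, 'p::finite) multigerm \<Rightarrow> bool" where
  "minimal_corank f \<longleftrightarrow>
     (\<forall>i\<in>branches f.
        rank (matrix (frechet_derivative (branch_map f i) (at (base_point f i)))) \<ge>
        min CARD('n) CARD('p) - 1)"


section \<open>Two-parameter unfoldings and the cuspidal germ\<close>

text \<open>With \<open>CARD('m) = n - 2\<close>, the type \<open>'k ^ 'm coord\<close> is \<open>n\<close>-dimensional space with coordinates
  \<open>(x, y, z)\<close>, where \<open>x\<close> has \<open>n - 2\<close> components.\<close>

datatype 'm coord = CX 'm | CY | CZ

instance coord :: (finite) finite
proof
  have "(UNIV :: 'a coord set) = range CX \<union> {CY, CZ}"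
    by (auto intro: coord.exhaust)
  then show "finite (UNIV :: 'a coord set)"
    by (metis finite.emptyI finite_Un finite_imageI finite_insert finite)
qed

definition point :: "'k^'m \<Rightarrow> 'k \<Rightarrow> 'k \<Rightarrow> 'k ^ 'm::finite coord" where
  "point x y z = (\<chi> i. case i of CX j \<Rightarrow> x $ j | CY \<Rightarrow> y | CZ \<Rightarrow> z)"

definition x_part :: "'k ^ 'm::finite coord \<Rightarrow> 'k^'m" where
  "x_part p = (\<chi> j. p $ CX j)"

definition unfolding_map ::
  "('k \<times> 'k \<Rightarrow> 'k^'m \<Rightarrow> 'k^'m) \<Rightarrow> 'k ^ 'm::finite coord \<Rightarrow> 'k ^ 'm coord" where
  "unfolding_map fl p = point (fl (p $ CY, p $ CZ) (x_part p)) (p $ CY) (p $ CZ)"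

definition stable_unfolding ::
  "('k::real_normed_field^'m::finite) set \<Rightarrow> ('k^'m \<Rightarrow> 'k^'m) \<Rightarrow> ('k \<times> 'k \<Rightarrow> 'k^'m \<Rightarrow> 'k^'m) \<Rightarrow>
   ('k ^ 'm coord, 'k, 'm coord, 'm coord) multigerm \<Rightarrow> bool" where
  "stable_unfolding S f fl F \<longleftrightarrow>
     F = germ_along ((\<lambda>s. point s 0 0) ` S) (unfolding_map fl) \<and>
     (\<forall>s\<in>S. \<forall>\<^sub>F x in nhds s. fl (0, 0) x = f x) \<and>
     is_multigerm F \<and> stable F"

definition cuspidal_map :: "'k::real_normed_field ^ 'm::finite coord \<Rightarrow> 'k ^ 'm coord" where
  "cuspidal_map p = point (x_part p) (p $ CY) ((p $ CZ)^3 + p $ CY * p $ CZ)"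

definition cuspidal_germ ::
  "('k ^ 'm coord, 'k::real_normed_field, 'm::finite coord, 'm coord) multigerm" where
  "cuspidal_germ = germ_along {0} cuspidal_map"


section \<open>The quotient of function germs in the variables \<open>(x, z)\<close>\<close>

text \<open>A point of \<open>'k ^ 'm option\<close> is \<open>(x, z)\<close>: the component at \<open>Some j\<close> is \<open>x\<^sub>j\<close>, the one at
  \<open>None\<close> is \<open>z\<close>.\<close>

definition function_germs :: "('k::real_normed_field^'q \<Rightarrow> 'k) set" where
  "function_germs = {h. regular_at h 0}"

definition cuspidal_restriction ::
  "('k::real_normed_field ^ 'm::finite coord \<Rightarrow> 'k ^ 'm coord) \<Rightarrow> 'k ^ 'm option \<Rightarrow> 'k" where
  "cuspidal_restriction \<eta> q =
     (let z = q $ None; p = point (\<chi> j. q $ Some j) (-3 * z^2) (-2 * z^3)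
      in - z * \<eta> p $ CY + \<eta> p $ CZ)"

definition cuspidal_subspace ::
  "('i, 'k::real_normed_field, 'm::finite coord, 'm coord) multigerm \<Rightarrow> ('k ^ 'm option \<Rightarrow> 'k) set"
  where
  "cuspidal_subspace F =
     {\<xi> \<in> function_germs. \<exists>\<eta>\<in>Lift F. \<forall>\<^sub>F q in nhds 0. \<xi> q = cuspidal_restriction \<eta> q}"

end

theory Submission
  imports Defs "HOL-Complex_Analysis.Cauchy_Integral_Formula"
begin

text \<open>As \<open>F\<close> is stable, every element of \<open>\<theta>({F,g})\<close> can be made zero on \<open>F\<close> modulo the tangent space, and
  what remains is \<open>\<theta>(g)/(tg(\<theta>\<^sub>n) + wg(Lift(F)))\<close>.  The image of \<open>dg\<close> consists of the \<open>v\<close> for which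
  \<open>v\<^sub>n - z v\<^sub>n\<^sub>-\<^sub>1\<close> is divisible by \<open>3z\<^sup>2 + y\<close>, that is (Hadamard's lemma) vanishes on \<open>y = -3z\<^sup>2\<close>; so
  restricting \<open>v\<^sub>n - z v\<^sub>n\<^sub>-\<^sub>1\<close> to \<open>y = -3z\<^sup>2\<close>, where \<open>g = (x, -3z\<^sup>2, -2z\<^sup>3)\<close>, identifies \<open>\<theta>(g)/tg(\<theta>\<^sub>n)\<close> with
  \<open>\<O>\<^sub>n\<^sub>-\<^sub>1\<close> and \<open>wg(Lift(F))\<close> with the subspace divided out.  For a holomorphic function, the
  differentiability of its partial derivatives, on which Hadamard's lemma rests, comes from Cauchy's
  formula on circles in the coordinate directions.\<close>

section \<open>Calculus over the ground field\<close>

text \<open>The last row of the Jacobian of g is (0, z, 3z^2 + y). Subtracting z times the y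
  component from the last one therefore eliminates the y component of a source field and leaves a
  multiple of 3z^2 + y, which disappears for y = -3z^2. A target field acts on all branches at once,
  and this is the only link between F and g: a target field may be used freely on g exactly if its
  effect on F can be undone by a source field, which is membership in Lift(F). Two obstacles shape
  the proof. Real smoothness is given by iterated directional derivatives, holomorphy by the mere
  existence of one complex linear derivative; a common class described by derivative coefficients
  lets the chain rule and Hadamard's lemma be proved once for both fields. Moreover, germs are
  represented by functions, and the function h attached to a field v is determined only modulo the
  subspace divided out, so the quotients are compared through a linear relation instead of a
  map.\<close>

lemma norm_axis_vec: "norm (axis j x :: 'k::real_normed_vector^'n) = norm x"
proof -
  have "(\<Sum>i\<in>UNIV. (norm (axis j x $ i))\<^sup>2) = (\<Sum>i\<in>UNIV. if i = j then (norm x)\<^sup>2 else 0)"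
    by (rule sum.cong) (auto simp: axis_def)
  then show ?thesis by (simp add: norm_vec_def L2_set_def)
qed

lemma bounded_linear_axis: "bounded_linear (axis j :: 'k::real_normed_vector \<Rightarrow> 'k^'n)"
proof (rule bounded_linear_intro[of _ 1])
  show "norm (axis j x) \<le> norm x * 1" for x :: 'k by (simp add: norm_axis_vec)
qed (auto simp: vec_eq_iff axis_def)

lemma sum_axis_nth: "(\<Sum>j\<in>UNIV. axis j (v $ j)) = (v :: 'k::comm_monoid_add^'n)"
  by (simp add: vec_eq_iff axis_def)

lemma has_derivative_vecI:
  fixes \<phi> :: "'a::real_normed_vector \<Rightarrow> 'k::real_normed_vector^'n"
  assumes "\<And>j. ((\<lambda>x. \<phi> x $ j) has_derivative (\<lambda>v. \<phi>' v $ j)) F"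
  shows "(\<phi> has_derivative \<phi>') F"
proof -
  have "((\<lambda>x. \<Sum>j\<in>UNIV. axis j (\<phi> x $ j)) has_derivative (\<lambda>v. \<Sum>j\<in>UNIV. axis j (\<phi>' v $ j))) F"
    by (intro has_derivative_sum bounded_linear.has_derivative[OF bounded_linear_axis] assms)
  then show ?thesis by (simp add: sum_axis_nth)
qed

text \<open>Derivatives are linear over the ground field, so this is the class \<open>C\<^sup>k\<close> over the reals, while over
  the complex numbers already \<open>k = 1\<close> means holomorphic.\<close>

primrec K_differentiable_on ::
  "nat \<Rightarrow> ('k::real_normed_field^'n \<Rightarrow> 'k) \<Rightarrow> ('k^'n) set \<Rightarrow> bool" where
  "K_differentiable_on 0 h U \<longleftrightarrow> continuous_on U h"
| "K_differentiable_on (Suc k) h U \<longleftrightarrow>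
     (\<exists>D. (\<forall>x\<in>U. (h has_derivative (\<lambda>v. \<Sum>i\<in>UNIV. D i x * v $ i)) (at x)) \<and>
          (\<forall>i. K_differentiable_on k (D i) U))"

lemma K_differentiable_on_cong:
  assumes "open U" "K_differentiable_on k h U" "\<And>x. x \<in> U \<Longrightarrow> h x = h' x"
  shows "K_differentiable_on k h' U"
proof (cases k)
  case 0
  then show ?thesis using assms continuous_on_cong by force
next
  case (Suc m)
  then obtain D where D: "\<And>x. x \<in> U \<Longrightarrow> (h has_derivative (\<lambda>v. \<Sum>i\<in>UNIV. D i x * v $ i)) (at x)"
    "\<And>i. K_differentiable_on m (D i) U"
    using assms(2) by auto
  have "(h' has_derivative (\<lambda>v. \<Sum>i\<in>UNIV. D i x * v $ i)) (at x)" if "x \<in> U" for x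
    using D(1)[OF that] assms(1) that assms(3) by (rule has_derivative_transform_within_open)
  then show ?thesis using D(2) Suc by auto
qed

lemma K_differentiable_on_imp_continuous_on:
  "K_differentiable_on k h U \<Longrightarrow> continuous_on U h"
  by (cases k) (auto intro!: continuous_at_imp_continuous_on dest!: has_derivative_continuous)

lemma K_differentiable_on_SucD: "K_differentiable_on (Suc k) h U \<Longrightarrow> K_differentiable_on k h U"
proof (induction k arbitrary: h)
  case 0
  then show ?case
    using K_differentiable_on_imp_continuous_on[of "Suc 0" h U] by simp
next
  case (Suc k)
  from Suc.prems obtain D where
    "\<forall>x\<in>U. (h has_derivative (\<lambda>v. \<Sum>i\<in>UNIV. D i x * v $ i)) (at x)"
    "\<forall>i. K_differentiable_on (Suc k) (D i) U"
    unfolding K_differentiable_on.simps(2)[of "Suc k"] by blast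
  with Suc.IH show ?case unfolding K_differentiable_on.simps(2)[of k] by blast
qed

lemma K_differentiable_on_subset:
  "K_differentiable_on k h U \<Longrightarrow> V \<subseteq> U \<Longrightarrow> K_differentiable_on k h V"
proof (induction k arbitrary: h)
  case 0
  then show ?case by (auto intro: continuous_on_subset)
next
  case (Suc k)
  then show ?case unfolding K_differentiable_on.simps by (meson subsetD)
qed

lemma K_differentiable_on_const: "K_differentiable_on k (\<lambda>x. c) U"
proof (induction k arbitrary: c)
  case (Suc k)
  then show ?case
    unfolding K_differentiable_on.simps by (intro exI[of _ "\<lambda>i x. 0"]) auto
qed auto

lemma K_differentiable_on_nth: "K_differentiable_on k (\<lambda>x. x $ i) U"
proof (cases k)
  case 0
  then show ?thesis by (auto intro: continuous_intros)
next
  case (Suc m)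
  have "((\<lambda>x. x $ i) has_derivative (\<lambda>v. \<Sum>j\<in>UNIV. (if j = i then 1 else 0) * v $ j)) (at x)"
    for x :: "'a^'b"
    by (simp add: if_distrib[of "\<lambda>a. a * _"] bounded_linear.has_derivative[OF bounded_linear_vec_nth]
        has_derivative_ident cong: if_cong)
  then show ?thesis
    unfolding Suc K_differentiable_on.simps
    by (intro exI[of _ "\<lambda>j x. if j = i then 1 else 0"]) (simp add: K_differentiable_on_const)
qed

lemma K_differentiable_on_add:
  "K_differentiable_on k f U \<Longrightarrow> K_differentiable_on k g U \<Longrightarrow>
   K_differentiable_on k (\<lambda>x. f x + g x) U"
proof (induction k arbitrary: f g)
  case 0
  then show ?case by (auto intro: continuous_intros)
next
  case (Suc k)
  from Suc.prems obtain D E where D: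
    "\<forall>x\<in>U. (f has_derivative (\<lambda>v. \<Sum>i\<in>UNIV. D i x * v $ i)) (at x)"
    "\<forall>i. K_differentiable_on k (D i) U"
    "\<forall>x\<in>U. (g has_derivative (\<lambda>v. \<Sum>i\<in>UNIV. E i x * v $ i)) (at x)"
    "\<forall>i. K_differentiable_on k (E i) U" by auto
  have "((\<lambda>x. f x + g x) has_derivative (\<lambda>v. \<Sum>i\<in>UNIV. (D i x + E i x) * v $ i)) (at x)"
    if "x \<in> U" for x
    using has_derivative_add[OF D(1)[rule_format, OF that] D(3)[rule_format, OF that]]
    by (simp add: sum.distrib distrib_right)
  moreover have "K_differentiable_on k (\<lambda>x. D i x + E i x) U" for i
    using D by (intro Suc.IH) auto
  ultimately show ?case
    unfolding K_differentiable_on.simps by (intro exI[of _ "\<lambda>i x. D i x + E i x"]) auto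
qed

lemma K_differentiable_on_mult:
  "K_differentiable_on k f U \<Longrightarrow> K_differentiable_on k g U \<Longrightarrow>
   K_differentiable_on k (\<lambda>x. f x * g x) U"
proof (induction k arbitrary: f g)
  case 0
  then show ?case by (auto intro: continuous_intros)
next
  case (Suc k)
  from Suc.prems obtain D E where D:
    "\<forall>x\<in>U. (f has_derivative (\<lambda>v. \<Sum>i\<in>UNIV. D i x * v $ i)) (at x)"
    "\<forall>i. K_differentiable_on k (D i) U"
    "\<forall>x\<in>U. (g has_derivative (\<lambda>v. \<Sum>i\<in>UNIV. E i x * v $ i)) (at x)"
    "\<forall>i. K_differentiable_on k (E i) U" by auto
  have "((\<lambda>x. f x * g x) has_derivative (\<lambda>v. \<Sum>i\<in>UNIV. (f x * E i x + D i x * g x) * v $ i)) (at x)"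
    if "x \<in> U" for x
    using has_derivative_mult[of f _ x UNIV g, OF D(1)[rule_format, OF that] D(3)[rule_format, OF that]]
    by (simp add: sum_distrib_left sum_distrib_right sum.distrib algebra_simps)
  moreover have "K_differentiable_on k (\<lambda>x. f x * E i x + D i x * g x) U" for i
    by (intro K_differentiable_on_add Suc.IH K_differentiable_on_SucD[OF Suc.prems(1)]
        K_differentiable_on_SucD[OF Suc.prems(2)] D(2)[rule_format] D(4)[rule_format])
  ultimately show ?case
    unfolding K_differentiable_on.simps by (intro exI[of _ "\<lambda>i x. f x * E i x + D i x * g x"]) auto
qed

lemma K_differentiable_on_sum:
  assumes "\<And>j. j \<in> J \<Longrightarrow> K_differentiable_on k (f j) U"
  shows "K_differentiable_on k (\<lambda>x. \<Sum>j\<in>J. f j x) U"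
  using assms
  by (induction J rule: infinite_finite_induct)
    (auto intro: K_differentiable_on_const K_differentiable_on_add)

text \<open>The chain rule gives the coefficients as sums of
  \<open>D j (\<phi> x) * E j i x\<close>. The outer function changes from \<open>h\<close> to
  \<open>D j\<close> while the inner map stays the same, so the induction runs over all
  \<open>h\<close> with \<open>\<phi>\<close> fixed.\<close>

lemma K_differentiable_on_compose:
  fixes \<phi> :: "'k::real_normed_field^'n \<Rightarrow> 'k^'p"
  assumes "K_differentiable_on k h V" "\<And>j. K_differentiable_on k (\<lambda>x. \<phi> x $ j) U" "\<phi> ` U \<subseteq> V"
  shows "K_differentiable_on k (\<lambda>x. h (\<phi> x)) U"
  using assms
proof (induction k arbitrary: h)
  case 0
  have "continuous_on U (\<lambda>x. \<chi> j. \<phi> x $ j)"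
    using 0 by (intro continuous_on_vec_lambda) auto
  then have "continuous_on U \<phi>" by simp
  then show ?case
    using 0 by (simp add: continuous_on_compose2)
next
  case (Suc k)
  from Suc.prems(1) obtain D where D:
    "\<forall>x\<in>V. (h has_derivative (\<lambda>v. \<Sum>i\<in>UNIV. D i x * v $ i)) (at x)"
    "\<forall>i. K_differentiable_on k (D i) V" by auto
  from Suc.prems(2) have
    "\<forall>j. \<exists>E. (\<forall>x\<in>U. ((\<lambda>x. \<phi> x $ j) has_derivative (\<lambda>v. \<Sum>i\<in>UNIV. E i x * v $ i)) (at x)) \<and>
      (\<forall>i. K_differentiable_on k (E i) U)"
    by simp
  then obtain E where
    "\<forall>j. (\<forall>x\<in>U. ((\<lambda>x. \<phi> x $ j) has_derivative (\<lambda>v. \<Sum>i\<in>UNIV. E j i x * v $ i)) (at x)) \<and>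
      (\<forall>i. K_differentiable_on k (E j i) U)"
    unfolding choice_iff by blast
  then have E:
    "\<And>x j. x \<in> U \<Longrightarrow> ((\<lambda>x. \<phi> x $ j) has_derivative (\<lambda>v. \<Sum>i\<in>UNIV. E j i x * v $ i)) (at x)"
    "\<And>j i. K_differentiable_on k (E j i) U"
    by auto
  have "((\<lambda>x. h (\<phi> x)) has_derivative
      (\<lambda>v. \<Sum>i\<in>UNIV. (\<Sum>j\<in>UNIV. D j (\<phi> x) * E j i x) * v $ i)) (at x)" if "x \<in> U" for x
  proof -
    have "(\<phi> has_derivative (\<lambda>v. \<chi> j. \<Sum>i\<in>UNIV. E j i x * v $ i)) (at x)"
      using E(1) that by (intro has_derivative_vecI) auto
    moreover have "(h has_derivative (\<lambda>v. \<Sum>i\<in>UNIV. D i (\<phi> x) * v $ i)) (at (\<phi> x))"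
      using D(1) that Suc.prems(3) by auto
    ultimately have "((\<lambda>x. h (\<phi> x)) has_derivative
      (\<lambda>v. \<Sum>j\<in>UNIV. D j (\<phi> x) * (\<chi> j. \<Sum>i\<in>UNIV. E j i x * v $ i) $ j)) (at x)"
      by (rule has_derivative_compose)
    moreover have "(\<Sum>j\<in>UNIV. D j (\<phi> x) * (\<chi> j. \<Sum>i\<in>UNIV. E j i x * v $ i) $ j) =
        (\<Sum>i\<in>UNIV. (\<Sum>j\<in>UNIV. D j (\<phi> x) * E j i x) * v $ i)" for v
      by (simp add: sum_distrib_left sum_distrib_right mult.assoc) (rule sum.swap)
    ultimately show ?thesis by (simp only:)
  qed
  moreover have "K_differentiable_on k (\<lambda>x. D j (\<phi> x)) U" for j
    by (rule Suc.IH[OF D(2)[rule_format] K_differentiable_on_SucD[OF Suc.prems(2)] Suc.prems(3)])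
  then have "K_differentiable_on k (\<lambda>x. \<Sum>j\<in>UNIV. D j (\<phi> x) * E j i x) U" for i
    using E(2) by (intro K_differentiable_on_sum K_differentiable_on_mult)
  ultimately show ?case
    unfolding K_differentiable_on.simps by (intro exI[of _ "\<lambda>i x. \<Sum>j\<in>UNIV. D j (\<phi> x) * E j i x"]) auto
qed

text \<open>Serves both Cauchy's integral and the integral in Hadamard's lemma. The Leibniz rule
  asks for a derivative that is continuous as an operator-valued function of \<open>(x, t)\<close>;
  continuity of the finitely many coefficients is enough for that.\<close>

lemma has_derivative_integral_param:
  fixes f :: "'k::{real_normed_field,banach}^'n \<Rightarrow> real \<Rightarrow> 'k"
  assumes "open U" "convex U" "x \<in> U"
    and f: "\<And>x t. x \<in> U \<Longrightarrow> t \<in> {0..1} \<Longrightarrow>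
         ((\<lambda>x. f x t) has_derivative (\<lambda>v. \<Sum>i\<in>UNIV. D i x t * v $ i)) (at x)"
    and int: "\<And>x. x \<in> U \<Longrightarrow> continuous_on {0..1} (f x)"
    and cont: "\<And>i. continuous_on (U \<times> {0..1}) (\<lambda>(x, t). D i x t)"
  shows "((\<lambda>x. integral {0..1} (f x)) has_derivative
          (\<lambda>v. \<Sum>i\<in>UNIV. integral {0..1} (D i x) * v $ i)) (at x)"
proof -
  \<comment> \<open>The operator is assembled from fixed coordinate projections followed by
    multiplication with a scalar, so its continuity in the operator norm reduces to that of the
    scalars \<open>D i x t\<close>.\<close>
  define pr where "pr i = Blinfun (\<lambda>v::'k^'n. v $ i)" for i
  have pr: "blinfun_apply (pr i) = (\<lambda>v. v $ i)" for i
    unfolding pr_def by (rule bounded_linear_Blinfun_apply) (rule bounded_linear_vec_nth)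
  define fx where "fx x t = (\<Sum>i\<in>UNIV. blinfun_mult_right (D i x t) o\<^sub>L pr i)" for x t
  have app: "blinfun_apply (fx x t) = (\<lambda>v. \<Sum>i\<in>UNIV. D i x t * v $ i)" for x t
    by (auto simp: fx_def blinfun.sum_left pr)
  have cfx: "continuous_on (U \<times> {0..1}) (\<lambda>(x, t). fx x t)"
    unfolding fx_def split_def
    by (intro continuous_intros bounded_linear.continuous_on[OF bounded_linear_blinfun_mult_right]
        cont[unfolded split_def])
  have "((\<lambda>x. integral (cbox 0 1) (f x)) has_derivative integral (cbox 0 1) (fx x)) (at x within U)"
  proof (rule leibniz_rule)
    show "((\<lambda>x. f x t) has_derivative blinfun_apply (fx x t)) (at x within U)"
      if "x \<in> U" "t \<in> cbox 0 1" for x t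
      using f[of x t] that by (auto simp: app intro: has_derivative_at_withinI)
    show "f x integrable_on cbox 0 1" if "x \<in> U" for x
      using int[OF that] by (simp add: integrable_continuous_interval)
  qed (use cfx assms in auto)
  moreover have "blinfun_apply (integral (cbox 0 1) (fx x)) =
      (\<lambda>v. \<Sum>i\<in>UNIV. integral {0..1} (D i x) * v $ i)"
  proof
    fix v
    have pair: "continuous_on {0..1} (\<lambda>t::real. (x, t))"
      by (intro continuous_intros)
    have sub: "(\<lambda>t. (x, t)) ` {0..1} \<subseteq> U \<times> {0..1}"
      using \<open>x \<in> U\<close> by blast
    have ix: "continuous_on {0..1} (fx x)"
      using continuous_on_compose2[OF cfx pair sub] by simp
    have iD: "D i x integrable_on {0..1}" for i
      using continuous_on_compose2[OF cont[of i] pair sub]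
      by (intro integrable_continuous_interval) simp
    have "blinfun_apply (integral (cbox 0 1) (fx x)) v = integral {0..1} (\<lambda>t. blinfun_apply (fx x t) v)"
      using integral_linear[OF integrable_continuous_interval[OF ix] blinfun.bounded_linear_left[of v]]
      by (simp add: o_def)
    also have "\<dots> = (\<Sum>i\<in>UNIV. integral {0..1} (\<lambda>t. D i x t * v $ i))"
      unfolding app by (rule integral_sum) (simp_all add: integrable_on_mult_left iD)
    finally show "blinfun_apply (integral (cbox 0 1) (fx x)) v =
       (\<Sum>i\<in>UNIV. integral {0..1} (D i x) * v $ i)" by simp
  qed
  ultimately show ?thesis
    unfolding at_within_open[OF assms(3,1)] by (simp only: box_real)
qed

lemma continuous_on_integral_param:
  fixes f :: "'a::topological_space \<Rightarrow> real \<Rightarrow> 'c::banach"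
  assumes "continuous_on (U \<times> {0..1}) (\<lambda>(x, t). f x t)"
  shows "continuous_on U (\<lambda>x. integral {0..1} (f x))"
  using integral_continuous_on_param[of U 0 1 f] assms by simp

section \<open>Partial derivatives and agreement with real smoothness\<close>

definition partial :: "('k::real_normed_field^'n \<Rightarrow> 'k) \<Rightarrow> 'n \<Rightarrow> 'k^'n \<Rightarrow> 'k" where
  "partial h i x = frechet_derivative h (at x) (axis i 1)"

lemma partial_eqI:
  assumes "(h has_derivative (\<lambda>v. \<Sum>i\<in>UNIV. a i * v $ i)) (at x)"
  shows "partial h i x = a i"
  unfolding partial_def frechet_derivative_at[OF assms, symmetric]
  by (simp add: axis_def if_distrib cong: if_cong)

text \<open>The coefficients of a derivative are its values at the unit vectors, hence unique on
  \<open>U\<close>; the existentially quantified \<open>D\<close> can therefore be replaced by the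
  canonical \<open>partial h\<close>.\<close>

lemma K_differentiable_on_Suc_iff:
  assumes "open U"
  shows "K_differentiable_on (Suc k) h U \<longleftrightarrow>
    (\<forall>x\<in>U. (h has_derivative (\<lambda>v. \<Sum>i\<in>UNIV. partial h i x * v $ i)) (at x)) \<and>
    (\<forall>i. K_differentiable_on k (partial h i) U)" (is "?L \<longleftrightarrow> ?R")
proof
  assume ?L
  then obtain D where D: "\<And>x. x \<in> U \<Longrightarrow> (h has_derivative (\<lambda>v. \<Sum>i\<in>UNIV. D i x * v $ i)) (at x)"
    "\<And>i. K_differentiable_on k (D i) U"
    by auto
  have "D i x = partial h i x" if "x \<in> U" for i x
    using partial_eqI[OF D(1)[OF that]] by simp
  with D K_differentiable_on_cong[OF assms D(2)] show ?R by auto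
qed auto

definition K_regular_at :: "('k::real_normed_field^'n \<Rightarrow> 'k) \<Rightarrow> 'k^'n \<Rightarrow> bool" where
  "K_regular_at h a \<longleftrightarrow> (\<exists>U. open U \<and> a \<in> U \<and> (\<forall>k. K_differentiable_on k h U))"

text \<open>One class differentiates along arbitrary directions, the other along coordinate
  directions only. By linearity a directional derivative is a combination of partial derivatives
  with constant coefficients, and such combinations preserve the order \<open>k\<close>.\<close>

lemma C_differentiable_on_iff_K_differentiable_on:
  fixes h :: "real^'n \<Rightarrow> real"
  assumes "open U"
  shows "C_differentiable_on k h U \<longleftrightarrow> K_differentiable_on k h U"
proof (induction k arbitrary: h)
  case (Suc k)
  have deriv: "(h has_derivative (\<lambda>v. \<Sum>i\<in>UNIV. partial h i x * v $ i)) (at x)"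
    if "h differentiable (at x)" for x
  proof -
    let ?D = "frechet_derivative h (at x)"
    have D: "(h has_derivative ?D) (at x)"
      using that frechet_derivative_works by blast
    then have "linear ?D" by (rule has_derivative_linear)
    then have "?D v = (\<Sum>i\<in>UNIV. partial h i x * v $ i)" for v
    proof -
      have "?D v = ?D (\<Sum>i\<in>UNIV. v $ i *\<^sub>R axis i 1)"
        by (metis basis_expansion scalar_mult_eq_scaleR)
      also have "\<dots> = (\<Sum>i\<in>UNIV. v $ i *\<^sub>R ?D (axis i 1))"
        using \<open>linear ?D\<close> by (simp add: linear_sum linear_scale)
      finally show ?thesis by (simp add: partial_def mult.commute)
    qed
    then have "?D = (\<lambda>v. \<Sum>i\<in>UNIV. partial h i x * v $ i)" by (rule ext)
    with D show ?thesis by (simp only:)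
  qed
  show ?case
  proof
    assume "C_differentiable_on (Suc k) h U"
    with Suc.IH deriv show "K_differentiable_on (Suc k) h U"
      unfolding K_differentiable_on_Suc_iff[OF assms] by (simp add: partial_def[abs_def])
  next
    assume K: "K_differentiable_on (Suc k) h U"
    then have K': "(h has_derivative (\<lambda>v. \<Sum>i\<in>UNIV. partial h i x * v $ i)) (at x)"
      "K_differentiable_on k (partial h i) U" if "x \<in> U" for x i
      using that K_differentiable_on_Suc_iff[OF assms] by blast+
    have "K_differentiable_on k (\<lambda>x. frechet_derivative h (at x) v) U" for v
    proof (rule K_differentiable_on_cong[OF assms])
      show "K_differentiable_on k (\<lambda>x. \<Sum>i\<in>UNIV. partial h i x * v $ i) U"
        using K unfolding K_differentiable_on_Suc_iff[OF assms]
        by (intro K_differentiable_on_sum K_differentiable_on_mult K_differentiable_on_const) auto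
      show "(\<Sum>i\<in>UNIV. partial h i x * v $ i) = frechet_derivative h (at x) v" if "x \<in> U" for x
        using frechet_derivative_at[OF K'(1)[OF that]] by metis
    qed
    then show "C_differentiable_on (Suc k) h U"
      using K'(1) by (auto simp: Suc.IH intro: differentiableI)
  qed
qed simp

lemma regular_at_real_iff: "regular_at (h :: real^'n \<Rightarrow> real) a \<longleftrightarrow> K_regular_at h a"
  unfolding regular_at_real K_regular_at_def smooth_on_def
  using C_differentiable_on_iff_K_differentiable_on by metis

section \<open>Holomorphic functions of several variables\<close>

lemma multi_holomorphic_on_has_derivative:
  assumes "multi_holomorphic_on h U" "x \<in> U"
  shows "(h has_derivative (\<lambda>v. \<Sum>i\<in>UNIV. partial h i x * v $ i)) (at x)"
proof -
  obtain a :: "'a^'b" where a: "(h has_derivative (\<lambda>v. \<Sum>i\<in>UNIV. a $ i * v $ i)) (at x)"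
    using assms unfolding multi_holomorphic_on_def by blast
  show ?thesis using a partial_eqI[OF a] by simp
qed

text \<open>Cauchy's formula for the derivative at 0 of the one-variable function
  \<open>\<zeta> \<mapsto> h (w + axis i \<zeta>)\<close>. On the circle u = r e^(2 pi i t) one has
  du = 2 pi i u dt, which cancels the constant and one of the two factors u in the denominator. The
  path does not depend on \<open>w\<close>, so \<open>w\<close> enters the integral through the
  values of \<open>h\<close> only.\<close>

lemma partial_eq_integral:
  fixes h :: "complex^'n \<Rightarrow> complex"
  assumes h: "multi_holomorphic_on h U" and "r > 0" "cball w r \<subseteq> U"
  shows "partial h i w =
    integral {0..1} (\<lambda>t. h (w + axis i (circlepath 0 r t)) / circlepath 0 r t)"
proof -
  define G where "G \<zeta> = h (w + axis i \<zeta>)" for \<zeta>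
  have G: "(G has_field_derivative partial h i (w + axis i \<zeta>)) (at \<zeta>)" if "\<zeta> \<in> cball 0 r" for \<zeta>
  proof -
    have "w + axis i \<zeta> \<in> U"
      using assms(3) that by (intro subsetD[OF assms(3)]) (simp add: dist_norm norm_axis_vec)
    note h' = multi_holomorphic_on_has_derivative[OF h this]
    have "((\<lambda>\<zeta>. w + axis i \<zeta>) has_derivative (\<lambda>\<zeta>. 0 + axis i \<zeta>)) (at \<zeta>)"
      by (intro has_derivative_add has_derivative_const
          bounded_linear.has_derivative[OF bounded_linear_axis] has_derivative_ident)
    from has_derivative_compose[OF this h'] show ?thesis
      unfolding has_field_derivative_def G_def
      by (simp add: axis_def if_distrib[of "\<lambda>x. _ * x"] cong: if_cong)
  qed
  have "continuous_on (cball 0 r) G"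
    using G by (meson DERIV_continuous continuous_at_imp_continuous_on)
  moreover have "G holomorphic_on ball 0 r"
    using G by (force simp: holomorphic_on_open)
  ultimately have "(G has_field_derivative
      (1 / (2 * of_real pi * \<i>) * contour_integral (circlepath 0 r) (\<lambda>u. G u / (u - 0)^2))) (at 0)"
    using \<open>r > 0\<close> by (intro Cauchy_derivative_integral_circlepath) auto
  moreover have axis0: "axis i (0::complex) = 0"
    by simp
  ultimately have "partial h i w =
     1 / (2 * of_real pi * \<i>) * contour_integral (circlepath 0 r) (\<lambda>u. G u / (u - 0)^2)"
    using DERIV_unique[OF _ G[of 0]] \<open>r > 0\<close> by (simp add: axis0)
  also have "\<dots> = 1 / (2 * of_real pi * \<i>) *
      integral {0..1} (\<lambda>t. (2 * of_real pi * \<i>) * (G (circlepath 0 r t) / circlepath 0 r t))"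
  proof -
    have "G c / (c - 0)^2 * vector_derivative (circlepath 0 r) (at t) = 2 * of_real pi * \<i> * (G c / c)"
      if "c = circlepath 0 r t" for c t
    proof -
      have "c \<noteq> 0" using that \<open>r > 0\<close> by (simp add: circlepath)
      moreover have "vector_derivative (circlepath 0 r) (at t) = 2 * of_real pi * \<i> * c"
        unfolding that vector_derivative_circlepath by (simp add: circlepath)
      ultimately show ?thesis by (simp add: power2_eq_square)
    qed
    then show ?thesis unfolding contour_integral_integral by simp
  qed
  also have "\<dots> = integral {0..1} (\<lambda>t. G (circlepath 0 r t) / circlepath 0 r t)"
    unfolding integral_mult_right by simp
  finally show ?thesis by (simp add: G_def)
qed

text \<open>Cauchy's formula is used twice. Continuity of \<open>h\<close> under the integral makes
  all partial derivatives continuous, and this continuity is what differentiation under the integral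
  then requires. It has to be derived, because \<open>multi_holomorphic_on\<close> asserts only that
  a derivative exists at each point.\<close>

lemma multi_holomorphic_on_partial:
  fixes h :: "complex^'n \<Rightarrow> complex"
  assumes h: "multi_holomorphic_on h U" and "open U"
  shows "multi_holomorphic_on (partial h i) U"
proof -
  note deriv = multi_holomorphic_on_has_derivative[OF h]
  have hc: "continuous_on U h"
    using deriv has_derivative_continuous continuous_at_imp_continuous_on by blast
  \<comment> \<open>The formula is applied at all centres near \<open>x\<close> with one and the
    same radius; half the radius of a ball inside \<open>U\<close> leaves room for both the shift of
    the centre and the circle.\<close>
  have local: "\<exists>r>0. (\<forall>w\<in>ball x r. cball w r \<subseteq> U)" if x: "x \<in> U" for x
  proof -
    obtain e where e: "e > 0" "ball x e \<subseteq> U"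
      using \<open>open U\<close> x openE by blast
    have "cball w (e/2) \<subseteq> U" if "w \<in> ball x (e/2)" for w
    proof
      fix y assume "y \<in> cball w (e/2)"
      then have "dist x y < e"
        using that dist_triangle[of x y w] by simp
      then show "y \<in> U" using e by auto
    qed
    with e show ?thesis by (intro exI[of _ "e/2"]) auto
  qed
  \<comment> \<open>Stated for any continuous \<open>g\<close>: it is applied to \<open>h\<close>
    itself and, once these are known to be continuous, to its partial derivatives.\<close>
  have shift: "continuous_on (ball x r \<times> {0..1})
      (\<lambda>(w, t). g (w + axis j (circlepath 0 r t)) / circlepath 0 r t)"
    if "continuous_on U g" "r > 0" "\<forall>w\<in>ball x r. cball w r \<subseteq> U" for g :: "complex^'n \<Rightarrow> complex" and x r j
  proof -
    have "continuous_on (ball x r \<times> {0..1})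
       (\<lambda>p. fst p + axis j (circlepath 0 r (snd p)))"
      unfolding circlepath
      by (intro continuous_intros bounded_linear.continuous_on[OF bounded_linear_axis])
    moreover have "(\<lambda>p. fst p + axis j (circlepath 0 r (snd p))) ` (ball x r \<times> {0..1}) \<subseteq> U"
    proof clarsimp
      fix w and t :: real assume "dist x w < r"
      then have "cball w r \<subseteq> U" using that by simp
      moreover have "w + axis j (circlepath 0 r t) \<in> cball w r"
        using \<open>r > 0\<close> by (simp add: dist_norm norm_axis_vec circlepath norm_mult)
      ultimately show "w + axis j (circlepath 0 r t) \<in> U" by blast
    qed
    ultimately have "continuous_on (ball x r \<times> {0..1})
       (\<lambda>p. g (fst p + axis j (circlepath 0 r (snd p))))"
      by (rule continuous_on_compose2[OF that(1)])
    moreover have "continuous_on (ball x r \<times> {0..1}) (\<lambda>p. circlepath 0 r (snd p))"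
      unfolding circlepath by (intro continuous_intros)
    ultimately show ?thesis
      unfolding split_def using \<open>r > 0\<close>
      by (intro continuous_on_divide) (auto simp: circlepath)
  qed
  have cont: "continuous_on U (partial h j)" for j
  proof (rule continuous_at_imp_continuous_on, rule ballI)
    fix x assume "x \<in> U"
    then obtain r where r: "r > 0" "\<forall>w\<in>ball x r. cball w r \<subseteq> U" using local by blast
    have "continuous_on (ball x r) (partial h j)"
    proof (subst continuous_on_cong[OF refl])
      show "partial h j w = integral {0..1} (\<lambda>t. h (w + axis j (circlepath 0 r t)) / circlepath 0 r t)"
        if "w \<in> ball x r" for w
        using partial_eq_integral[OF h r(1)] r(2) that by blast
    qed (rule continuous_on_integral_param[OF shift[OF hc r]])
    then show "isCont (partial h j) x"
      using r(1) by (simp add: continuous_on_eq_continuous_at)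
  qed
  have "\<exists>a. (partial h i has_derivative (\<lambda>v. \<Sum>j\<in>UNIV. a $ j * v $ j)) (at x)" if "x \<in> U" for x
  proof -
    obtain r where r: "r > 0" "\<forall>w\<in>ball x r. cball w r \<subseteq> U" using local \<open>x \<in> U\<close> by blast
    let ?c = "circlepath 0 r"
    have "((\<lambda>w. integral {0..1} (\<lambda>t. h (w + axis i (?c t)) / ?c t)) has_derivative
      (\<lambda>v. \<Sum>j\<in>UNIV. integral {0..1} (\<lambda>t. partial h j (x + axis i (?c t)) / ?c t) * v $ j)) (at x)"
    proof (rule has_derivative_integral_param)
      show "((\<lambda>w. h (w + axis i (?c t)) / ?c t) has_derivative
          (\<lambda>v. \<Sum>j\<in>UNIV. partial h j (w + axis i (?c t)) / ?c t * v $ j)) (at w)"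
        if "w \<in> ball x r" for w and t :: real
      proof -
        have "w + axis i (?c t) \<in> cball w r"
          using \<open>r > 0\<close> by (simp add: dist_norm norm_axis_vec circlepath norm_mult)
        then have "w + axis i (?c t) \<in> U" using r(2) that by blast
        note h' = deriv[OF this]
        have "((\<lambda>w. w + axis i (?c t)) has_derivative (\<lambda>v. v + 0)) (at w)"
          by (intro has_derivative_add has_derivative_const has_derivative_ident)
        from has_derivative_compose[OF this h'] have
          "((\<lambda>w. h (w + axis i (?c t))) has_derivative
            (\<lambda>v. \<Sum>j\<in>UNIV. partial h j (w + axis i (?c t)) * v $ j)) (at w)" by simp
        from has_derivative_mult_left[OF this, of "inverse (?c t)"] show ?thesis
          by (simp add: divide_inverse sum_distrib_left mult_ac)
      qed
      show "continuous_on (ball x r \<times> {0..1}) (\<lambda>(w, t). partial h j (w + axis i (?c t)) / ?c t)" for j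
        by (rule shift[OF cont r])
      show "continuous_on {0..1} (\<lambda>t. h (w + axis i (?c t)) / ?c t)" if "w \<in> ball x r" for w
      proof -
        have "continuous_on {0..1} (\<lambda>t::real. (w, t))" by (intro continuous_intros)
        moreover have "(\<lambda>t. (w, t)) ` {0..1} \<subseteq> ball x r \<times> {0..1}" using that by blast
        ultimately show ?thesis
          using continuous_on_compose2[OF shift[OF hc r]] by fastforce
      qed
    qed (use r in auto)
    then have "(partial h i has_derivative
      (\<lambda>v. \<Sum>j\<in>UNIV. integral {0..1} (\<lambda>t. partial h j (x + axis i (?c t)) / ?c t) * v $ j)) (at x)"
    proof (rule has_derivative_transform_within_open)
      show "open (ball x r)" "x \<in> ball x r" using r by auto
      show "integral {0..1} (\<lambda>t. h (w + axis i (?c t)) / ?c t) = partial h i w"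
        if "w \<in> ball x r" for w
        using partial_eq_integral[OF h r(1)] r(2) that by simp
    qed
    then show ?thesis
      by (intro exI[of _ "\<chi> j. integral {0..1} (\<lambda>t. partial h j (x + axis i (?c t)) / ?c t)"])
        (simp only: vec_lambda_beta)
  qed
  then show ?thesis unfolding multi_holomorphic_on_def by blast
qed

text \<open>Forwards, partial derivatives are again holomorphic, so the order can be raised by an
  induction over all \<open>h\<close>; backwards, order one already gives the complex linear
  derivative.\<close>

lemma multi_holomorphic_on_iff_K_differentiable_on:
  fixes h :: "complex^'n \<Rightarrow> complex"
  assumes "open U"
  shows "multi_holomorphic_on h U \<longleftrightarrow> (\<forall>k. K_differentiable_on k h U)"
proof
  assume h: "multi_holomorphic_on h U"
  have "K_differentiable_on k h U" for k
    using h
  proof (induction k arbitrary: h)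
    case 0
    from multi_holomorphic_on_has_derivative[OF this] have "isCont h x" if "x \<in> U" for x
      using that has_derivative_continuous by blast
    then show ?case by (simp add: continuous_at_imp_continuous_on)
  next
    case (Suc k)
    show ?case
      unfolding K_differentiable_on_Suc_iff[OF assms]
      by (intro conjI ballI allI Suc.IH multi_holomorphic_on_has_derivative[OF Suc.prems]
          multi_holomorphic_on_partial[OF Suc.prems assms])
  qed
  then show "\<forall>k. K_differentiable_on k h U" by blast
next
  assume "\<forall>k. K_differentiable_on k h U"
  then have "K_differentiable_on (Suc 0) h U" by blast
  then obtain D where "\<forall>x\<in>U. (h has_derivative (\<lambda>v. \<Sum>i\<in>UNIV. D i x * v $ i)) (at x)"
    unfolding K_differentiable_on.simps by blast
  then have "\<forall>x\<in>U. (h has_derivative (\<lambda>v. \<Sum>i\<in>UNIV. (\<chi> i. D i x) $ i * v $ i)) (at x)"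
    by simp
  then show "multi_holomorphic_on h U"
    unfolding multi_holomorphic_on_def by blast
qed

lemma regular_at_complex_iff: "regular_at (h :: complex^'n \<Rightarrow> complex) a \<longleftrightarrow> K_regular_at h a"
  unfolding regular_at_complex K_regular_at_def
  using multi_holomorphic_on_iff_K_differentiable_on by metis

section \<open>Hadamard's lemma\<close>

text \<open>The straight path to \<open>w\<close>, reached at \<open>s = 1\<close>, from its
  projection to the hyperplane \<open>w $ i = 0\<close> at \<open>s = 0\<close>. The parameter is
  real over either field, so integrals over the unit interval serve both.\<close>

definition shrink :: "'n \<Rightarrow> real \<Rightarrow> 'k::real_normed_field^'n \<Rightarrow> 'k^'n" where
  "shrink i s w = (\<chi> j. if j = i then of_real s * w $ j else w $ j)"

lemma shrink_nth: "shrink i s w $ j = of_real (if j = i then s else 1) * w $ j"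
  by (simp add: shrink_def)

lemma norm_shrink_le: "s \<in> {0..1} \<Longrightarrow> norm (shrink i s w) \<le> norm w"
  unfolding norm_vec_def
  by (rule L2_set_mono) (auto simp: shrink_nth norm_mult mult_left_le_one_le)

lemma shrink_in_ball: "s \<in> {0..1} \<Longrightarrow> w \<in> ball 0 r \<Longrightarrow> shrink i s w \<in> ball 0 r"
  using norm_shrink_le[of s i w] by simp

lemma has_derivative_shrink: "(shrink i s has_derivative shrink i s) (at w)"
proof (rule has_derivative_vecI)
  fix j
  show "((\<lambda>x. shrink i s x $ j) has_derivative (\<lambda>v. shrink i s v $ j)) (at w)"
    unfolding shrink_nth
    by (intro has_derivative_mult_right bounded_linear.has_derivative[OF bounded_linear_vec_nth]
        has_derivative_ident)
qed

lemma continuous_on_shrink: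
  fixes q :: "'k::{real_normed_field,banach}^'n \<Rightarrow> 'k"
  assumes "continuous_on (ball 0 r) q"
  shows "continuous_on (ball 0 r \<times> {0..1}) (\<lambda>(w, s). of_real (s ^ m) * q (shrink i s w))"
proof -
  have "continuous_on (ball 0 r \<times> {0..1}) (\<lambda>p. shrink i (snd p) (fst p) :: 'k^'n)"
    unfolding shrink_def
  proof (rule continuous_on_vec_lambda)
    show "continuous_on (ball 0 r \<times> {0..1})
      (\<lambda>p. if j = i then of_real (snd p) * fst p $ j else fst p $ j :: 'k)" for j
      by (cases "j = i") (auto intro!: continuous_intros)
  qed
  moreover have "(\<lambda>p. shrink i (snd p) (fst p)) ` (ball 0 r \<times> {0..1}) \<subseteq> ball 0 r"
    using shrink_in_ball by fastforce
  ultimately have "continuous_on (ball 0 r \<times> {0..1}) (\<lambda>p. q (shrink i (snd p) (fst p)))"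
    by (rule continuous_on_compose2[OF assms])
  then show ?thesis
    unfolding split_def by (intro continuous_intros)
qed

lemma continuous_on_section:
  assumes "continuous_on (U \<times> T) (\<lambda>(x, t). f x t)" "x \<in> U"
  shows "continuous_on T (f x)"
proof -
  have "continuous_on T (Pair x)" by (intro continuous_intros)
  moreover have "Pair x ` T \<subseteq> U \<times> T" using assms(2) by blast
  ultimately show ?thesis using continuous_on_compose2[OF assms(1)] by fastforce
qed

text \<open>Differentiating \<open>q (shrink i s w)\<close> in the direction \<open>i\<close> brings
  out a factor \<open>s\<close>. The weight \<open>s ^ m\<close> with arbitrary \<open>m\<close>
  makes the statement reproduce itself under differentiation.\<close>

lemma K_differentiable_on_integral_shrink:
  fixes q :: "'k::{real_normed_field,banach}^'n \<Rightarrow> 'k"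
  assumes "K_differentiable_on k q (ball 0 r)"
  shows "K_differentiable_on k (\<lambda>w. integral {0..1} (\<lambda>s. of_real (s ^ m) * q (shrink i s w))) (ball 0 r)"
  using assms
proof (induction k arbitrary: q m)
  case 0
  then show ?case
    using continuous_on_integral_param[OF continuous_on_shrink[of r q m i]] by simp
next
  case (Suc k)
  have q: "(q has_derivative (\<lambda>v. \<Sum>j\<in>UNIV. partial q j x * v $ j)) (at x)" if "x \<in> ball 0 r" for x
    using Suc.prems that K_differentiable_on_Suc_iff[OF open_ball] by blast
  have pq: "K_differentiable_on k (partial q j) (ball 0 r)" for j
    using Suc.prems K_differentiable_on_Suc_iff[OF open_ball] by blast
  \<comment> \<open>The exponent after differentiation in the direction \<open>j\<close>: only the
    scaled coordinate contributes another \<open>s\<close>.\<close>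
  define n where "n j = (if j = i then Suc m else m)" for j
  have "((\<lambda>w. integral {0..1} (\<lambda>s. of_real (s ^ m) * q (shrink i s w))) has_derivative
    (\<lambda>v. \<Sum>j\<in>UNIV. integral {0..1} (\<lambda>s. of_real (s ^ n j) * partial q j (shrink i s x)) * v $ j)) (at x)"
    if "x \<in> ball 0 r" for x
  proof (rule has_derivative_integral_param)
    fix w :: "'k^'n" and s :: real assume w: "w \<in> ball 0 r" "s \<in> {0..1}"
    from has_derivative_compose[OF has_derivative_shrink q[OF shrink_in_ball[OF w(2,1)]]]
    have "((\<lambda>w. of_real (s ^ m) * q (shrink i s w)) has_derivative
      (\<lambda>v. of_real (s ^ m) * (\<Sum>j\<in>UNIV. partial q j (shrink i s w) * shrink i s v $ j))) (at w)"
      by (rule has_derivative_mult_right)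
    moreover have "of_real (s ^ m) * (\<Sum>j\<in>UNIV. partial q j (shrink i s w) * shrink i s v $ j) =
      (\<Sum>j\<in>UNIV. of_real (s ^ n j) * partial q j (shrink i s w) * v $ j)" for v
      unfolding sum_distrib_left by (rule sum.cong) (auto simp: shrink_nth n_def)
    ultimately show "((\<lambda>w. of_real (s ^ m) * q (shrink i s w)) has_derivative
      (\<lambda>v. \<Sum>j\<in>UNIV. of_real (s ^ n j) * partial q j (shrink i s w) * v $ j)) (at w)"
      by (simp only:)
  next
    fix w :: "'k^'n" assume "w \<in> ball 0 r"
    then show "continuous_on {0..1} (\<lambda>s. of_real (s ^ m) * q (shrink i s w))"
      using continuous_on_section[OF continuous_on_shrink]
        K_differentiable_on_imp_continuous_on[OF Suc.prems] by blast
  next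
    show "continuous_on (ball 0 r \<times> {0..1})
       (\<lambda>(w, s). of_real (s ^ n j) * partial q j (shrink i s w))" for j
      by (intro continuous_on_shrink K_differentiable_on_imp_continuous_on[OF pq])
  qed (use that in auto)
  moreover have "K_differentiable_on k
    (\<lambda>x. integral {0..1} (\<lambda>s. of_real (s ^ n j) * partial q j (shrink i s x))) (ball 0 r)" for j
    by (rule Suc.IH[OF pq])
  ultimately show ?case
    unfolding K_differentiable_on.simps
    by (intro exI[of _ "\<lambda>j x. integral {0..1} (\<lambda>s. of_real (s ^ n j) * partial q j (shrink i s x))"]
        conjI ballI allI)
qed

text \<open>Since \<open>P\<close> vanishes at \<open>shrink i 0 w\<close>, the value
  \<open>P w\<close> is the integral over \<open>s\<close> of the derivative of
  \<open>P (shrink i s w)\<close>, and that derivative is \<open>w $ i\<close> times a partial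
  derivative of \<open>P\<close>. On a ball around 0 the whole path stays in the domain.\<close>

lemma hadamard_ball:
  fixes P :: "'k::{real_normed_field,banach}^'n \<Rightarrow> 'k"
  assumes P: "\<And>k. K_differentiable_on k P (ball 0 r)"
    and zero: "\<And>w. w \<in> ball 0 r \<Longrightarrow> w $ i = 0 \<Longrightarrow> P w = 0"
  obtains Q where "\<forall>k. K_differentiable_on k Q (ball 0 r)" "\<forall>w\<in>ball 0 r. P w = w $ i * Q w"
proof
  \<comment> \<open>The weight \<open>s ^ 0\<close> is 1; it brings \<open>Q\<close> into the form
    whose regularity is already known.\<close>
  define Q where "Q w = integral {0..1} (\<lambda>s. of_real (s ^ 0) * partial P i (shrink i s w))" for w
  note iff = K_differentiable_on_Suc_iff[OF open_ball]
  have pP: "K_differentiable_on k (partial P i) (ball 0 r)" for k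
    using P[of "Suc k"] iff by blast
  show "\<forall>k. K_differentiable_on k Q (ball 0 r)"
    unfolding Q_def by (intro allI K_differentiable_on_integral_shrink[OF pP])
  show "\<forall>w\<in>ball 0 r. P w = w $ i * Q w"
  proof
    fix w :: "'k^'n" assume w: "w \<in> ball 0 r"
    have "((\<lambda>s. P (shrink i s w)) has_vector_derivative w $ i * partial P i (shrink i s w))
          (at s within {0..1})" if "s \<in> {0..1}" for s
    proof -
      have "((\<lambda>s. shrink i s w) has_derivative (\<lambda>h. axis i (of_real h * w $ i))) (at s)"
      proof (rule has_derivative_vecI)
        show "((\<lambda>s. shrink i s w $ j) has_derivative (\<lambda>h. axis i (of_real h * w $ i) $ j)) (at s)" for j
          unfolding shrink_nth axis_def
          by (cases "j = i") (auto intro!: derivative_eq_intros)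
      qed
      moreover have "(P has_derivative (\<lambda>v. \<Sum>j\<in>UNIV. partial P j (shrink i s w) * v $ j)) (at (shrink i s w))"
        using P[of "Suc 0"] iff shrink_in_ball[OF that w] by blast
      ultimately have "((\<lambda>s. P (shrink i s w)) has_derivative
         (\<lambda>h. \<Sum>j\<in>UNIV. partial P j (shrink i s w) * axis i (of_real h * w $ i) $ j)) (at s)"
        by (rule has_derivative_compose)
      then have "((\<lambda>s. P (shrink i s w)) has_vector_derivative w $ i * partial P i (shrink i s w)) (at s)"
        unfolding has_vector_derivative_def
        by (simp add: axis_def if_distrib[of "\<lambda>x. _ * x"] scaleR_conv_of_real mult_ac cong: if_cong)
      then show ?thesis by (rule has_vector_derivative_at_within)
    qed
    from fundamental_theorem_of_calculus[OF _ this]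
    have "((\<lambda>s. w $ i * partial P i (shrink i s w)) has_integral P (shrink i 1 w) - P (shrink i 0 w)) {0..1}"
      by simp
    moreover have "shrink i 1 w = w" "P (shrink i 0 w) = 0"
      using zero[OF shrink_in_ball[of 0 w r i]] w by (auto simp: shrink_nth vec_eq_iff)
    ultimately show "P w = w $ i * Q w"
      unfolding Q_def by (auto dest: integral_unique)
  qed
qed

section \<open>Germs of regular functions\<close>

lemma K_regular_at_ball:
  assumes "K_regular_at h a"
  obtains r where "r > 0" "\<And>k. K_differentiable_on k h (ball a r)"
proof -
  from assms obtain U where U: "open U" "a \<in> U" "\<And>k. K_differentiable_on k h U"
    unfolding K_regular_at_def by blast
  then obtain r where "r > 0" "ball a r \<subseteq> U" using openE by blast
  with U that show ?thesis using K_differentiable_on_subset by blast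
qed

lemma K_regular_at_const: "K_regular_at (\<lambda>x. c) a"
  unfolding K_regular_at_def using K_differentiable_on_const by blast

lemma K_regular_at_nth: "K_regular_at (\<lambda>x. x $ i) a"
  unfolding K_regular_at_def using K_differentiable_on_nth by blast

lemma K_regular_at_add:
  assumes "K_regular_at f a" "K_regular_at g a" shows "K_regular_at (\<lambda>x. f x + g x) a"
proof -
  from assms obtain U V where "open U" "a \<in> U" "\<And>k. K_differentiable_on k f U"
     "open V" "a \<in> V" "\<And>k. K_differentiable_on k g V"
    unfolding K_regular_at_def by blast
  then show ?thesis
    unfolding K_regular_at_def
    by (intro exI[of _ "U \<inter> V"] conjI allI K_differentiable_on_add)
      (auto intro: K_differentiable_on_subset)
qed

lemma K_regular_at_mult:
  assumes "K_regular_at f a" "K_regular_at g a" shows "K_regular_at (\<lambda>x. f x * g x) a"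
proof -
  from assms obtain U V where "open U" "a \<in> U" "\<And>k. K_differentiable_on k f U"
     "open V" "a \<in> V" "\<And>k. K_differentiable_on k g V"
    unfolding K_regular_at_def by blast
  then show ?thesis
    unfolding K_regular_at_def
    by (intro exI[of _ "U \<inter> V"] conjI allI K_differentiable_on_mult)
      (auto intro: K_differentiable_on_subset)
qed

lemma K_regular_at_uminus: "K_regular_at f a \<Longrightarrow> K_regular_at (\<lambda>x. - f x) a"
  using K_regular_at_mult[OF K_regular_at_const[of "-1"]] by simp

lemma K_regular_at_diff:
  "K_regular_at f a \<Longrightarrow> K_regular_at g a \<Longrightarrow> K_regular_at (\<lambda>x. f x - g x) a"
  using K_regular_at_add[OF _ K_regular_at_uminus] by simp

lemma K_regular_at_power: "K_regular_at f a \<Longrightarrow> K_regular_at (\<lambda>x. f x ^ n) a"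
  by (induction n) (auto intro: K_regular_at_const K_regular_at_mult)

lemma K_regular_at_continuous: "K_regular_at f a \<Longrightarrow> isCont f a"
  unfolding K_regular_at_def
  by (meson K_differentiable_on_imp_continuous_on continuous_on_eq_continuous_at)

lemma continuous_vecI:
  fixes \<phi> :: "'a::t2_space \<Rightarrow> 'b::topological_space^'n"
  assumes "\<And>j. isCont (\<lambda>x. \<phi> x $ j) a" shows "isCont \<phi> a"
  using assms unfolding isCont_def by (intro vec_tendstoI)

lemma K_regular_at_compose:
  fixes \<phi> :: "'k::real_normed_field^'n \<Rightarrow> 'k^'p"
  assumes h: "K_regular_at h (\<phi> a)" and \<phi>: "\<And>j. K_regular_at (\<lambda>x. \<phi> x $ j) a"
  shows "K_regular_at (\<lambda>x. h (\<phi> x)) a"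
proof -
  from h obtain V where V: "open V" "\<phi> a \<in> V" "\<And>k. K_differentiable_on k h V"
    unfolding K_regular_at_def by blast
  from \<phi> have "\<forall>j. \<exists>U. open U \<and> a \<in> U \<and> (\<forall>k. K_differentiable_on k (\<lambda>x. \<phi> x $ j) U)"
    unfolding K_regular_at_def by blast
  then obtain U where U: "\<And>j. open (U j)" "\<And>j. a \<in> U j"
    "\<And>j k. K_differentiable_on k (\<lambda>x. \<phi> x $ j) (U j)"
    by metis
  let ?W = "\<Inter>j. U j"
  have W: "open ?W" "a \<in> ?W" using U by auto
  have "K_differentiable_on 0 (\<lambda>x. \<phi> x $ j) ?W" for j
    by (rule K_differentiable_on_subset[OF U(3)[where j=j]]) auto
  then have "continuous_on ?W (\<lambda>x. \<chi> j. \<phi> x $ j)"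
    by (intro continuous_on_vec_lambda) simp
  then have "continuous_on ?W \<phi>" by simp
  then have "open (\<phi> -` V \<inter> ?W)"
    using V(1) W(1) continuous_on_open_vimage by blast
  moreover have "K_differentiable_on k (\<lambda>x. h (\<phi> x)) (\<phi> -` V \<inter> ?W)" for k
  proof (rule K_differentiable_on_compose[OF V(3)])
    show "K_differentiable_on k (\<lambda>x. \<phi> x $ j) (\<phi> -` V \<inter> ?W)" for j
      by (rule K_differentiable_on_subset[OF U(3)]) auto
  qed auto
  ultimately show ?thesis
    unfolding K_regular_at_def using V(2) W(2) by (intro exI[of _ "\<phi> -` V \<inter> ?W"]) auto
qed

lemma K_regular_at_has_derivative:
  assumes "K_regular_at h a"
  shows "\<forall>\<^sub>F x in nhds a. (h has_derivative (\<lambda>v. \<Sum>i\<in>UNIV. partial h i x * v $ i)) (at x)"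
proof -
  from assms obtain U where U: "open U" "a \<in> U" "K_differentiable_on (Suc 0) h U"
    unfolding K_regular_at_def by blast
  then show ?thesis
    unfolding K_differentiable_on_Suc_iff[OF U(1)] eventually_nhds by blast
qed

lemma hadamard_germ:
  fixes P :: "'k::{real_normed_field,banach}^'n \<Rightarrow> 'k"
  assumes "K_regular_at P 0" "\<forall>\<^sub>F w in nhds 0. w $ i = 0 \<longrightarrow> P w = 0"
  obtains Q where "K_regular_at Q 0" "\<forall>\<^sub>F w in nhds 0. P w = w $ i * Q w"
proof -
  from assms(1) obtain r where r: "r > 0" "\<And>k. K_differentiable_on k P (ball 0 r)"
    using K_regular_at_ball by blast
  from assms(2) obtain e where e: "e > 0" "\<And>w. w \<in> ball 0 e \<Longrightarrow> w $ i = 0 \<Longrightarrow> P w = 0"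
    unfolding eventually_nhds_metric by (auto simp: dist_commute)
  let ?B = "ball (0::'k^'n) (min r e)"
  have "K_differentiable_on k P ?B" for k
    by (rule K_differentiable_on_subset[OF r(2)]) auto
  moreover have "P w = 0" if "w \<in> ?B" "w $ i = 0" for w
    using e(2) that by auto
  ultimately obtain Q where Q: "\<forall>k. K_differentiable_on k Q ?B" "\<forall>w\<in>?B. P w = w $ i * Q w"
    by (rule hadamard_ball)
  have B: "open ?B" "0 \<in> ?B" using r(1) e(1) by auto
  show ?thesis
  proof
    show "K_regular_at Q 0" unfolding K_regular_at_def using Q(1) B by blast
    show "\<forall>\<^sub>F w in nhds 0. P w = w $ i * Q w" unfolding eventually_nhds using Q(2) B by blast
  qed
qed

section \<open>Comparing quotient dimensions\<close>

text \<open>\<open>R\<close> plays the role of the graph of an isomorphism between the quotients: it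
  is linear, total on both sides and matches \<open>W\<close> with \<open>W'\<close>. A basis is
  carried over by choosing a partner for each of its elements. As the dimension is an infimum over
  bases, this gives one inequality, and reversing \<open>R\<close> gives the other.\<close>

lemma quotient_dim_le:
  fixes sc :: "'k::field \<Rightarrow> 'v::ab_group_add \<Rightarrow> 'v" and sc' :: "'k \<Rightarrow> 'w::ab_group_add \<Rightarrow> 'w"
  assumes sc: "module sc" "module sc'"
    and R0: "R 0 0"
    and R_add: "\<And>v w v' w'. R v w \<Longrightarrow> R v' w' \<Longrightarrow> R (v + v') (w + w')"
    and R_sc: "\<And>c v w. R v w \<Longrightarrow> R (sc c v) (sc' c w)"
    and left: "\<And>v. v \<in> V \<Longrightarrow> \<exists>w\<in>V'. R v w" and right: "\<And>w. w \<in> V' \<Longrightarrow> \<exists>v\<in>V. R v w"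
    and iff: "\<And>v w. R v w \<Longrightarrow> v \<in> W \<longleftrightarrow> w \<in> W'"
    and zero: "0 \<in> W'"
  shows "quotient_dim sc' V' W' \<le> quotient_dim sc V W"
  unfolding quotient_dim_def[of sc]
proof (rule INF_greatest)
  interpret S: module sc by (rule sc)
  interpret S': module sc' by (rule sc)
  fix B assume "B \<in> {B. finite B \<and> basis_modulo sc V W B}"
  then have B: "finite B" "B \<subseteq> V" "\<And>v. v \<in> V \<Longrightarrow> \<exists>c. v - (\<Sum>b\<in>B. sc (c b) b) \<in> W"
    "\<And>c. (\<Sum>b\<in>B. sc (c b) b) \<in> W \<Longrightarrow> \<forall>b\<in>B. c b = 0"
    unfolding basis_modulo_def by auto
  have "\<forall>b\<in>B. \<exists>w. w \<in> V' \<and> R b w" using left B(2) by blast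
  then obtain g where g: "\<And>b. b \<in> B \<Longrightarrow> g b \<in> V'" "\<And>b. b \<in> B \<Longrightarrow> R b (g b)"
    by metis
  have Rsum: "R (\<Sum>b\<in>A. sc (c b) b) (\<Sum>b\<in>A. sc' (c b) (g b))" if "A \<subseteq> B" for c A
    using finite_subset[OF that B(1)] that
    by induction (auto intro: R0 R_add R_sc g(2))
  have inj: "inj_on g B"
  proof (rule inj_onI, rule ccontr)
    fix b b' assume b: "b \<in> B" "b' \<in> B" "g b = g b'" "b \<noteq> b'"
    \<comment> \<open>The combination b - b' has the partner \<open>g b - g b' = 0\<close>, which
      lies in \<open>W'\<close>; so b - b' would lie in \<open>W\<close>, against
      independence.\<close>
    define c :: "'v \<Rightarrow> 'k" where "c x = (if x = b then 1 else if x = b' then -1 else 0)" for x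
    have "(\<Sum>x\<in>B. sc' (c x) (g x)) = (\<Sum>x\<in>{b,b'}. sc' (c x) (g x))"
      using B(1) b by (intro sum.mono_neutral_right) (auto simp: c_def)
    also have "\<dots> = 0" using b by (simp add: c_def)
    finally have "(\<Sum>x\<in>B. sc (c x) x) \<in> W"
      using iff[OF Rsum[OF order.refl, of c]] zero by simp
    then have "c b = 0" using B(4) b(1) by blast
    then show False by (simp add: c_def)
  qed
  have reindex: "(\<Sum>y\<in>g ` B. sc' (c y) y) = (\<Sum>b\<in>B. sc' (c (g b)) (g b))" for c
    by (simp add: sum.reindex[OF inj])
  have "basis_modulo sc' V' W' (g ` B)"
    unfolding basis_modulo_def
  proof (intro conjI ballI allI impI)
    show "g ` B \<subseteq> V'" using g(1) by blast
  next
    fix w assume "w \<in> V'"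
    then obtain v where v: "v \<in> V" "R v w" using right by blast
    then obtain c where c: "v - (\<Sum>b\<in>B. sc (c b) b) \<in> W" using B(3) by blast
    have "R (v + sc (-1) (\<Sum>b\<in>B. sc (c b) b)) (w + sc' (-1) (\<Sum>b\<in>B. sc' (c b) (g b)))"
      by (intro R_add R_sc v Rsum order.refl)
    then have "w - (\<Sum>b\<in>B. sc' (c b) (g b)) \<in> W'"
      using iff c by force
    moreover have "(\<Sum>b\<in>B. sc' (c b) (g b)) = (\<Sum>y\<in>g ` B. sc' (c (inv_into B g y)) y)"
      unfolding reindex by (rule sum.cong) (simp_all add: inv_into_f_f[OF inj])
    ultimately show "\<exists>c. w - (\<Sum>b\<in>g ` B. sc' (c b) b) \<in> W'" by metis
  next
    fix c y assume c: "(\<Sum>b\<in>g ` B. sc' (c b) b) \<in> W'" "y \<in> g ` B"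
    then have "(\<Sum>b\<in>B. sc (c (g b)) b) \<in> W"
      using iff[OF Rsum[OF order.refl, of "\<lambda>b. c (g b)"]] reindex by simp
    then show "c y = 0" using B(4)[of "\<lambda>b. c (g b)"] c(2) by blast
  qed
  then have "quotient_dim sc' V' W' \<le> enat (card (g ` B))"
    unfolding quotient_dim_def using B(1) by (intro INF_lower) simp
  then show "quotient_dim sc' V' W' \<le> enat (card B)"
    by (simp add: card_image[OF inj])
qed

lemma quotient_dim_eqI:
  fixes sc :: "'k::field \<Rightarrow> 'v::ab_group_add \<Rightarrow> 'v" and sc' :: "'k \<Rightarrow> 'w::ab_group_add \<Rightarrow> 'w"
  assumes sc: "module sc" "module sc'"
    and R0: "R 0 0"
    and R_add: "\<And>v w v' w'. R v w \<Longrightarrow> R v' w' \<Longrightarrow> R (v + v') (w + w')"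
    and R_sc: "\<And>c v w. R v w \<Longrightarrow> R (sc c v) (sc' c w)"
    and left: "\<And>v. v \<in> V \<Longrightarrow> \<exists>w\<in>V'. R v w" and right: "\<And>w. w \<in> V' \<Longrightarrow> \<exists>v\<in>V. R v w"
    and iff: "\<And>v w. R v w \<Longrightarrow> v \<in> W \<longleftrightarrow> w \<in> W'"
    and zero: "0 \<in> W'"
  shows "quotient_dim sc V W = quotient_dim sc' V' W'"
proof (rule antisym)
  show "quotient_dim sc' V' W' \<le> quotient_dim sc V W"
    by (rule quotient_dim_le[where R = R]) (use assms in auto)
  have "0 \<in> W" using iff[OF R0] zero by blast
  then show "quotient_dim sc V W \<le> quotient_dim sc' V' W'"
    by (intro quotient_dim_le[where R = "\<lambda>w v. R v w"]) (use assms in auto)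
qed

text \<open>The infimum of the empty set is \<infinity>, and any other infimum of extended naturals
  is attained. So the value 0 comes from a basis with no elements, and spanning by the empty set
  means lying in \<open>W\<close>.\<close>

lemma quotient_dim_eq_0:
  assumes "quotient_dim sc V W = 0" "v \<in> V"
  shows "v \<in> W"
proof -
  let ?S = "(\<lambda>B. enat (card B)) ` {B. finite B \<and> basis_modulo sc V W B}"
  have "Inf ?S = 0" using assms(1) unfolding quotient_dim_def .
  then have "?S \<noteq> {}" by (auto simp: Inf_enat_def split: if_splits)
  then have "Inf ?S \<in> ?S" by (auto simp: Inf_enat_def intro: LeastI)
  then obtain B where "finite B" "basis_modulo sc V W B" "enat (card B) = 0"
    unfolding \<open>Inf ?S = 0\<close> by auto
  then have "basis_modulo sc V W {}" by (simp add: zero_enat_def)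
  then show ?thesis using assms(2) by (auto simp: basis_modulo_def)
qed

section \<open>The cuspidal germ\<close>

lemma point_nth [simp]:
  "point x y z $ CX j = x $ j" "point x y z $ CY = y" "point x y z $ CZ = z"
  by (simp_all add: point_def)

lemma all_coord: "(\<forall>i. P i) \<longleftrightarrow> (\<forall>j. P (CX j)) \<and> P CY \<and> P CZ"
  by (metis coord.exhaust)

lemma point_eq_iff: "point x y z = p \<longleftrightarrow> (\<forall>j. x $ j = p $ CX j) \<and> y = p $ CY \<and> z = p $ CZ"
  by (simp add: vec_eq_iff all_coord)

lemma K_regular_at_point:
  assumes "\<And>j. K_regular_at (\<lambda>p. x p $ j) a" "K_regular_at y a" "K_regular_at z a"
  shows "K_regular_at (\<lambda>p. point (x p) (y p) (z p) $ i) a"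
  by (cases i) (auto simp: assms)

lemmas K_regular_at_intros =
  K_regular_at_const K_regular_at_nth K_regular_at_add K_regular_at_mult K_regular_at_uminus
  K_regular_at_diff K_regular_at_power K_regular_at_point

text \<open>Parametrizes by \<open>(x, z)\<close> the set 3z^2 + y = 0, where the differential of
  the cuspidal map is singular.\<close>

definition fold_point :: "'k::real_normed_field ^ 'm::finite option \<Rightarrow> 'k ^ 'm coord" where
  "fold_point q = point (\<chi> j. q $ Some j) (- 3 * (q $ None)\<^sup>2) (q $ None)"

lemma fold_point_0 [simp]: "fold_point 0 = 0"
  by (simp add: fold_point_def point_eq_iff)

text \<open>A left inverse of \<open>fold_point\<close> on the whole space: composing with it
  extends a function on the singular set to one independent of y.\<close>

definition drop_y :: "'k ^ 'm::finite coord \<Rightarrow> 'k ^ 'm option" where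
  "drop_y p = (\<chi> i. case i of Some j \<Rightarrow> p $ CX j | None \<Rightarrow> p $ CZ)"

lemma drop_y_nth [simp]: "drop_y p $ Some j = p $ CX j" "drop_y p $ None = p $ CZ"
  by (simp_all add: drop_y_def)

lemma drop_y_0 [simp]: "drop_y 0 = 0"
  by (simp add: vec_eq_iff drop_y_def split: option.split)

lemma drop_y_fold_point [simp]: "drop_y (fold_point q) = q"
  by (auto simp: vec_eq_iff fold_point_def drop_y_def split: option.split)

lemma K_regular_at_fold_point: "K_regular_at (\<lambda>q. fold_point q $ i) a"
  unfolding fold_point_def by (intro K_regular_at_intros) (simp_all add: K_regular_at_nth)

lemma K_regular_at_drop_y: "K_regular_at (\<lambda>p. drop_y p $ i) a"
  by (cases i) (simp_all add: K_regular_at_nth)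

lemma K_regular_at_cuspidal_map: "K_regular_at (\<lambda>p. cuspidal_map p $ i) a"
  unfolding cuspidal_map_def by (intro K_regular_at_intros) (simp_all add: x_part_def K_regular_at_nth)

lemma cuspidal_map_0 [simp]: "cuspidal_map 0 = 0"
  by (simp add: cuspidal_map_def point_eq_iff x_part_def)

lemma cuspidal_map_fold_point:
  "cuspidal_map (fold_point q) = point (\<chi> j. q $ Some j) (- 3 * (q $ None)\<^sup>2) (- 2 * (q $ None) ^ 3)"
  by (simp add: cuspidal_map_def fold_point_def point_eq_iff x_part_def power2_eq_square power3_eq_cube)

text \<open>For y = -3z^2 the last coordinate z^3 + yz becomes -2z^3, so \<open>\<eta>\<close> is
  evaluated at the critical values of the cuspidal map. The restriction is thus the last component
  minus z times the y component of \<open>\<eta> \<circ> cuspidal_map\<close> on the singular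
  set.\<close>

lemma cuspidal_restriction_eq:
  "cuspidal_restriction \<eta> q =
     \<eta> (cuspidal_map (fold_point q)) $ CZ - q $ None * \<eta> (cuspidal_map (fold_point q)) $ CY"
  by (simp add: cuspidal_restriction_def cuspidal_map_fold_point Let_def)

lemma frechet_derivative_cuspidal_map:
  fixes p :: "'k::real_normed_field ^ 'm::finite coord"
  shows "frechet_derivative cuspidal_map (at p) v =
    point (x_part v) (v $ CY) (p $ CZ * v $ CY + (3 * (p $ CZ)\<^sup>2 + p $ CY) * v $ CZ)"
proof -
  note nth = bounded_linear.has_derivative[OF bounded_linear_vec_nth has_derivative_ident]
  have "(cuspidal_map has_derivative
    (\<lambda>v. point (x_part v) (v $ CY) (p $ CZ * v $ CY + (3 * (p $ CZ)\<^sup>2 + p $ CY) * v $ CZ))) (at p)"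
  proof (rule has_derivative_vecI)
    fix i :: "'m coord"
    show "((\<lambda>p. cuspidal_map p $ i) has_derivative (\<lambda>v. point (x_part v) (v $ CY)
      (p $ CZ * v $ CY + (3 * (p $ CZ)\<^sup>2 + p $ CY) * v $ CZ) $ i)) (at p)"
    proof (cases i)
      case CZ
      have "((\<lambda>p. (p $ CZ)^3 + p $ CY * p $ CZ) has_derivative
        (\<lambda>v. p $ CZ * v $ CY + (3 * (p $ CZ)\<^sup>2 + p $ CY) * v $ CZ)) (at p)"
        using has_derivative_add[OF has_derivative_power[OF nth[of CZ], where n = 3]
            has_derivative_mult[OF nth[of CY] nth[of CZ]], of p UNIV]
        by (simp add: algebra_simps)
      with CZ show ?thesis by (simp add: cuspidal_map_def)
    qed (simp_all add: cuspidal_map_def x_part_def nth)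
  qed
  then show ?thesis by (simp flip: frechet_derivative_at)
qed

section \<open>Division by the equation of the singular set\<close>

lemma eventually_nhds_compose:
  assumes "\<forall>\<^sub>F x in nhds b. P x" "isCont \<phi> a" "\<phi> a = b"
  shows "\<forall>\<^sub>F x in nhds a. P (\<phi> x)"
proof -
  have "filterlim \<phi> (nhds b) (nhds a)"
    using assms(2) unfolding isCont_def tendsto_at_iff_tendsto_nhds assms(3)[symmetric] .
  then show ?thesis using assms(1) unfolding filterlim_iff by blast
qed

text \<open>The coordinate change \<open>(x, y, z) \<mapsto> (x, y - 3z\<^sup>2, z)\<close> moves the singular set of the cuspidal
  germ to the hyperplane \<open>y = 0\<close>.\<close>

lemma divide_by_fold:
  fixes P :: "'k::{real_normed_field,banach}^'m::finite coord \<Rightarrow> 'k"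
  assumes P: "K_regular_at P 0" and zero: "\<forall>\<^sub>F q in nhds 0. P (fold_point q) = 0"
  obtains Q where "K_regular_at Q 0"
    "\<forall>\<^sub>F p in nhds 0. P p = (3 * (p $ CZ)\<^sup>2 + p $ CY) * Q p"
proof -
  define \<sigma> :: "'k^'m coord \<Rightarrow> 'k^'m coord" where
    "\<sigma> p = point (x_part p) (p $ CY - 3 * (p $ CZ)\<^sup>2) (p $ CZ)" for p
  define \<tau> :: "'k^'m coord \<Rightarrow> 'k^'m coord" where
    "\<tau> p = point (x_part p) (p $ CY + 3 * (p $ CZ)\<^sup>2) (p $ CZ)" for p
  have reg: "K_regular_at (\<lambda>p. \<sigma> p $ i) a" "K_regular_at (\<lambda>p. \<tau> p $ i) a" for i a
    unfolding \<sigma>_def \<tau>_def by (intro K_regular_at_intros; simp add: x_part_def K_regular_at_nth)+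
  have [simp]: "\<sigma> 0 = 0" "\<tau> 0 = 0" "\<sigma> (\<tau> p) = p" for p
    by (simp_all add: \<sigma>_def \<tau>_def point_eq_iff x_part_def)
  \<comment> \<open>Once \<open>P \<circ> \<sigma>\<close> is divided by the coordinate y, composing
    with \<open>\<tau>\<close> undoes \<open>\<sigma>\<close> and turns y into the factor 3z^2 +
    y.\<close>
  have \<tau>_CY: "\<tau> p $ CY = 3 * (p $ CZ)\<^sup>2 + p $ CY" for p
    by (simp add: \<tau>_def)
  \<comment> \<open>The hypothesis concerns points \<open>(x, z)\<close>, whereas Hadamard's lemma
    works in the full space. \<open>drop_y\<close> passes between the two, and on y = 0 the map
    \<open>\<sigma>\<close> is \<open>fold_point\<close> after \<open>drop_y\<close>.\<close>
  have "\<forall>\<^sub>F p in nhds 0. P (fold_point (drop_y p)) = 0"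
    by (rule eventually_nhds_compose[where P = "\<lambda>q. P (fold_point q) = 0" and \<phi> = drop_y, OF zero])
      (rule continuous_vecI, rule K_regular_at_continuous, rule K_regular_at_drop_y, rule drop_y_0)
  moreover have "fold_point (drop_y p) = \<sigma> p" if "p $ CY = 0" for p
    using that by (simp add: fold_point_def \<sigma>_def x_part_def)
  ultimately have "\<forall>\<^sub>F p in nhds 0. p $ CY = 0 \<longrightarrow> P (\<sigma> p) = 0"
    by (auto elim!: eventually_mono)
  moreover have "K_regular_at (\<lambda>p. P (\<sigma> p)) 0"
    by (rule K_regular_at_compose) (simp_all add: P reg)
  ultimately obtain Q where Q: "K_regular_at Q 0" "\<forall>\<^sub>F p in nhds 0. P (\<sigma> p) = p $ CY * Q p"
    using hadamard_germ by blast
  show ?thesis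
  proof
    show "K_regular_at (\<lambda>p. Q (\<tau> p)) 0"
      by (rule K_regular_at_compose) (simp_all add: Q(1) reg)
    have "\<forall>\<^sub>F p in nhds 0. P (\<sigma> (\<tau> p)) = \<tau> p $ CY * Q (\<tau> p)"
      by (rule eventually_nhds_compose[where P = "\<lambda>p. P (\<sigma> p) = p $ CY * Q p" and \<phi> = \<tau>, OF Q(2)])
        (rule continuous_vecI, rule K_regular_at_continuous, rule reg(2), simp)
    then show "\<forall>\<^sub>F p in nhds 0. P p = (3 * (p $ CZ)\<^sup>2 + p $ CY) * Q (\<tau> p)"
      by (simp add: \<tau>_CY)
  qed
qed

lemma module_theta: "module (\<lambda>c v i x. c *s (v i x :: 'k::field^'n))"
  by unfold_locales
    (simp_all add: fun_eq_iff vector_add_ldistrib vector_sadd_rdistrib vector_smult_assoc)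

lemma module_function_germs: "module (\<lambda>c (h :: 'a \<Rightarrow> 'k::field) q. c * h q)"
  by unfold_locales (simp_all add: fun_eq_iff algebra_simps)

lemma fold_point_nth:
  "fold_point q $ CY = - 3 * (q $ None)\<^sup>2" "fold_point q $ CZ = q $ None"
  by (simp_all add: fold_point_def)

lemma Ball_Plus: "(\<forall>i\<in>A <+> B. P i) \<longleftrightarrow> (\<forall>a\<in>A. P (Inl a)) \<and> (\<forall>b\<in>B. P (Inr b))"
  by auto

lemma join_cuspidal_simps:
  "branches (join_germs F cuspidal_germ) = branches F <+> {0}"
  "base_point (join_germs F cuspidal_germ) = case_sum (base_point F) (\<lambda>s. s)"
  "branch_map (join_germs F cuspidal_germ) = case_sum (branch_map F) (\<lambda>s. cuspidal_map)"
  by (simp_all add: join_germs_def cuspidal_germ_def germ_along_def)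

text \<open>The rest of the argument uses the ground field only through these two equivalences.\<close>

locale K_regular_germs =
  fixes dim :: "'m::finite itself" and field_type :: "'k::{real_normed_field,banach} itself"
  assumes regular_at_coord: "\<And>(h :: 'k^'m coord \<Rightarrow> 'k) a. regular_at h a \<longleftrightarrow> K_regular_at h a"
    and regular_at_option: "\<And>(h :: 'k^'m option \<Rightarrow> 'k) a. regular_at h a \<longleftrightarrow> K_regular_at h a"
begin

section \<open>Regular maps and linearity of the tangent space\<close>

lemma map_regular_at_iff:
  "map_regular_at (\<phi> :: 'k^'m coord \<Rightarrow> 'k^'p) a \<longleftrightarrow> (\<forall>j. K_regular_at (\<lambda>x. \<phi> x $ j) a)"
  by (simp add: map_regular_at_def regular_at_coord)

lemma function_germs_iff: "(h :: 'k^'m option \<Rightarrow> 'k) \<in> function_germs \<longleftrightarrow> K_regular_at h 0"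
  by (simp add: function_germs_def regular_at_option)

lemma map_regular_at_add:
  "map_regular_at (\<phi> :: 'k^'m coord \<Rightarrow> 'k^'p) a \<Longrightarrow> map_regular_at \<psi> a \<Longrightarrow>
   map_regular_at (\<lambda>x. \<phi> x + \<psi> x) a"
  by (simp add: map_regular_at_iff K_regular_at_add)

lemma map_regular_at_smult:
  "map_regular_at (\<phi> :: 'k^'m coord \<Rightarrow> 'k^'p) a \<Longrightarrow> map_regular_at (\<lambda>x. c *s \<phi> x) a"
  by (simp add: map_regular_at_iff K_regular_at_mult K_regular_at_const)

lemma map_regular_at_uminus:
  "map_regular_at (\<phi> :: 'k^'m coord \<Rightarrow> 'k^'p) a \<Longrightarrow> map_regular_at (\<lambda>x. - \<phi> x) a"
  by (simp add: map_regular_at_iff K_regular_at_uminus)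

lemma map_regular_at_zero: "map_regular_at (\<lambda>x. 0 :: 'k^'p) (a :: 'k^'m coord)"
  by (simp add: map_regular_at_iff K_regular_at_const)

lemma map_regular_at_compose:
  fixes \<phi> :: "'k^'m coord \<Rightarrow> 'k^'m coord"
  assumes "map_regular_at \<eta> (\<phi> a)" "map_regular_at \<phi> a"
  shows "map_regular_at (\<lambda>x. \<eta> (\<phi> x)) a"
  unfolding map_regular_at_iff
proof
  fix j
  show "K_regular_at (\<lambda>x. \<eta> (\<phi> x) $ j) a"
    using assms K_regular_at_compose[of "\<lambda>p. \<eta> p $ j" \<phi> a] unfolding map_regular_at_iff by blast
qed

text \<open>\<open>frechet_derivative\<close> is defined by choice and need not be linear where no
  derivative exists; regularity supplies a derivative that is linear over the ground field at all
  points near \<open>a\<close>. The shape \<open>u + c *s v\<close> covers sums, scalar multiples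
  and the value at 0.\<close>

lemma linear_frechet_derivative_near:
  fixes \<phi> :: "'k^'m coord \<Rightarrow> 'k^'m coord"
  assumes "map_regular_at \<phi> a"
  shows "\<forall>\<^sub>F x in nhds a. \<forall>u v c. frechet_derivative \<phi> (at x) (u + c *s v) =
     frechet_derivative \<phi> (at x) u + c *s frechet_derivative \<phi> (at x) v"
proof -
  have "\<forall>\<^sub>F x in nhds a. \<forall>j. ((\<lambda>x. \<phi> x $ j) has_derivative
     (\<lambda>v. \<Sum>i\<in>UNIV. partial (\<lambda>x. \<phi> x $ j) i x * v $ i)) (at x)"
    using assms unfolding map_regular_at_iff
    by (intro eventually_all_finite) (simp add: K_regular_at_has_derivative)
  then show ?thesis
  proof (rule eventually_mono)
    fix x
    assume "\<forall>j. ((\<lambda>x. \<phi> x $ j) has_derivative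
     (\<lambda>v. \<Sum>i\<in>UNIV. partial (\<lambda>x. \<phi> x $ j) i x * v $ i)) (at x)"
    then have "(\<phi> has_derivative (\<lambda>v. \<chi> j. \<Sum>i\<in>UNIV. partial (\<lambda>x. \<phi> x $ j) i x * v $ i)) (at x)"
      by (intro has_derivative_vecI) simp
    from frechet_derivative_at[OF this, symmetric]
    show "\<forall>u v c. frechet_derivative \<phi> (at x) (u + c *s v) =
     frechet_derivative \<phi> (at x) u + c *s frechet_derivative \<phi> (at x) v"
      by (simp add: vec_eq_iff distrib_left sum.distrib sum_distrib_left mult.left_commute)
  qed
qed

lemma extended_tangent_space_add_smult:
  fixes f :: "('i, 'k, 'm coord, 'm coord) multigerm"
  assumes f: "is_multigerm f"
    and v: "v \<in> extended_tangent_space f" and w: "w \<in> extended_tangent_space f"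
  shows "(\<lambda>i x. v i x + c *s w i x) \<in> extended_tangent_space f"
proof -
  from v obtain \<xi> \<eta> where v': "v \<in> theta f" "\<xi> \<in> theta_source f" "\<eta> \<in> theta_target"
    "\<And>i. i \<in> branches f \<Longrightarrow> \<forall>\<^sub>F x in nhds (base_point f i).
      v i x = frechet_derivative (branch_map f i) (at x) (\<xi> i x) + \<eta> (branch_map f i x)"
    unfolding extended_tangent_space_def by blast
  from w obtain \<xi>' \<eta>' where w': "w \<in> theta f" "\<xi>' \<in> theta_source f" "\<eta>' \<in> theta_target"
    "\<And>i. i \<in> branches f \<Longrightarrow> \<forall>\<^sub>F x in nhds (base_point f i).
      w i x = frechet_derivative (branch_map f i) (at x) (\<xi>' i x) + \<eta>' (branch_map f i x)"
    unfolding extended_tangent_space_def by blast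
  show ?thesis
    unfolding extended_tangent_space_def
  proof (intro CollectI conjI bexI[of _ "\<lambda>i x. \<xi> i x + c *s \<xi>' i x"] bexI[of _ "\<lambda>x. \<eta> x + c *s \<eta>' x"] ballI)
    fix i assume i: "i \<in> branches f"
    have "map_regular_at (branch_map f i) (base_point f i)"
      using f i unfolding is_multigerm_def by blast
    from linear_frechet_derivative_near[OF this] v'(4)[OF i] w'(4)[OF i]
    show "\<forall>\<^sub>F x in nhds (base_point f i). v i x + c *s w i x =
      frechet_derivative (branch_map f i) (at x) (\<xi> i x + c *s \<xi>' i x) +
      (\<eta> (branch_map f i x) + c *s \<eta>' (branch_map f i x))"
      by eventually_elim (simp add: vector_add_ldistrib)
  qed (use v' w' in \<open>auto simp: theta_def theta_source_def theta_target_def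
        intro!: map_regular_at_add map_regular_at_smult\<close>)
qed

lemma zero_in_extended_tangent_space:
  fixes f :: "('i, 'k, 'm coord, 'm coord) multigerm"
  assumes f: "is_multigerm f"
  shows "(\<lambda>i x. 0) \<in> extended_tangent_space f"
  unfolding extended_tangent_space_def
proof (intro CollectI conjI bexI[of _ "\<lambda>i x. 0"] bexI[of _ "\<lambda>x. 0"] ballI)
  fix i assume i: "i \<in> branches f"
  have "map_regular_at (branch_map f i) (base_point f i)"
    using f i unfolding is_multigerm_def by blast
  from linear_frechet_derivative_near[OF this]
  show "\<forall>\<^sub>F x in nhds (base_point f i). 0 =
      frechet_derivative (branch_map f i) (at x) 0 + 0"
  proof eventually_elim
    case (elim x)
    \<comment> \<open>With u = v = 0 and c = 1, linearity of the derivative D reads D 0 = D 0 + D 0,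
      hence D 0 = 0.\<close>
    from elim[rule_format, of 0 1 0] show ?case by simp
  qed
qed (auto simp: theta_def theta_source_def theta_target_def map_regular_at_zero)

section \<open>The tangent space of the concatenation\<close>

lemma map_regular_at_cuspidal_map:
  "map_regular_at (cuspidal_map :: 'k^'m coord \<Rightarrow> 'k^'m coord) a"
  by (simp add: map_regular_at_iff K_regular_at_cuspidal_map)

lemma is_multigerm_join_cuspidal:
  fixes F :: "('i, 'k, 'm coord, 'm coord) multigerm"
  assumes "is_multigerm F"
  shows "is_multigerm (join_germs F cuspidal_germ)"
  using assms
  by (auto simp: is_multigerm_def join_germs_def cuspidal_germ_def germ_along_def
      map_regular_at_cuspidal_map)

lemma theta_join_cuspidal_iff:
  fixes F :: "('i, 'k, 'm coord, 'm coord) multigerm"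
  shows "v \<in> theta (join_germs F cuspidal_germ) \<longleftrightarrow>
    (\<lambda>i. v (Inl i)) \<in> theta F \<and> map_regular_at (v (Inr 0)) 0"
  by (simp add: theta_def join_cuspidal_simps Ball_Plus)

text \<open>The source fields on \<open>F\<close> and on the cuspidal branch are chosen
  independently, whereas a single target field \<open>\<eta>\<close> has to serve all
  branches.\<close>

lemma extended_tangent_space_join_cuspidal_iff:
  fixes F :: "('i, 'k, 'm coord, 'm coord) multigerm"
  shows "v \<in> extended_tangent_space (join_germs F cuspidal_germ) \<longleftrightarrow>
    v \<in> theta (join_germs F cuspidal_germ) \<and>
    (\<exists>\<xi>\<in>theta_source F. \<exists>\<zeta>. map_regular_at \<zeta> 0 \<and> (\<exists>\<eta>\<in>theta_target.
      (\<forall>i\<in>branches F. \<forall>\<^sub>F x in nhds (base_point F i).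
        v (Inl i) x = frechet_derivative (branch_map F i) (at x) (\<xi> i x) + \<eta> (branch_map F i x)) \<and>
      (\<forall>\<^sub>F p in nhds 0.
        v (Inr 0) p = frechet_derivative cuspidal_map (at p) (\<zeta> p) + \<eta> (cuspidal_map p))))"
    (is "_ \<longleftrightarrow> _ \<and> ?R")
proof -
  let ?G = "join_germs F cuspidal_germ"
  have "(\<exists>\<xi>\<in>theta_source ?G. \<exists>\<eta>\<in>theta_target. \<forall>i\<in>branches ?G.
        \<forall>\<^sub>F x in nhds (base_point ?G i).
          v i x = frechet_derivative (branch_map ?G i) (at x) (\<xi> i x) + \<eta> (branch_map ?G i x)) \<longleftrightarrow> ?R"
    (is "?L \<longleftrightarrow> _")
  proof
    assume ?L
    then obtain \<xi> \<eta> where *: "\<xi> \<in> theta_source ?G" "\<eta> \<in> theta_target" "\<And>i. i \<in> branches ?G \<Longrightarrow>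
        \<forall>\<^sub>F x in nhds (base_point ?G i).
          v i x = frechet_derivative (branch_map ?G i) (at x) (\<xi> i x) + \<eta> (branch_map ?G i x)"
      by blast
    show ?R
    proof (intro bexI[of _ "\<lambda>i. \<xi> (Inl i)"] exI[of _ "\<xi> (Inr 0)"] conjI bexI[of _ \<eta>] ballI)
      fix i assume "i \<in> branches F"
      then show "\<forall>\<^sub>F x in nhds (base_point F i).
        v (Inl i) x = frechet_derivative (branch_map F i) (at x) (\<xi> (Inl i) x) + \<eta> (branch_map F i x)"
        using *(3)[of "Inl i"] by (simp add: join_cuspidal_simps InlI)
    next
      show "\<forall>\<^sub>F p in nhds 0. v (Inr 0) p =
          frechet_derivative cuspidal_map (at p) (\<xi> (Inr 0) p) + \<eta> (cuspidal_map p)"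
        using *(3)[of "Inr 0"] by (simp add: join_cuspidal_simps InrI)
    qed (use *(1,2) in \<open>simp_all add: theta_source_def join_cuspidal_simps Ball_Plus\<close>)
  next
    assume ?R
    then obtain \<xi> \<zeta> \<eta> where *: "\<xi> \<in> theta_source F" "map_regular_at \<zeta> 0" "\<eta> \<in> theta_target"
      "\<forall>i\<in>branches F. \<forall>\<^sub>F x in nhds (base_point F i).
        v (Inl i) x = frechet_derivative (branch_map F i) (at x) (\<xi> i x) + \<eta> (branch_map F i x)"
      "\<forall>\<^sub>F p in nhds 0.
        v (Inr 0) p = frechet_derivative cuspidal_map (at p) (\<zeta> p) + \<eta> (cuspidal_map p)"
      by blast
    show ?L
      by (intro bexI[of _ "case_sum \<xi> (\<lambda>_. \<zeta>)"] bexI[of _ \<eta>])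
        (use * in \<open>simp_all add: theta_source_def join_cuspidal_simps Ball_Plus\<close>)
  qed
  then show ?thesis
    unfolding extended_tangent_space_def by blast
qed

text \<open>A normal form modulo the image of the differential: \<open>u\<close> reduces to a field
  whose only nonzero component is the last one, where it is independent of y. The remainder
  \<open>h\<close> is the obstruction read off on the singular set.\<close>

lemma cuspidal_division:
  fixes u :: "'k^'m coord \<Rightarrow> 'k^'m coord" and h :: "'k^'m option \<Rightarrow> 'k"
  assumes u: "map_regular_at u 0" and h: "K_regular_at h 0"
    and eq: "\<forall>\<^sub>F q in nhds 0. h q = u (fold_point q) $ CZ - q $ None * u (fold_point q) $ CY"
  obtains \<zeta> where "map_regular_at \<zeta> 0"
    "\<forall>\<^sub>F p in nhds 0. u p = frechet_derivative cuspidal_map (at p) (\<zeta> p) + point 0 0 (h (drop_y p))"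
proof -
  have u': "K_regular_at (\<lambda>p. u p $ j) 0" for j
    using u by (simp add: map_regular_at_iff)
  \<comment> \<open>On the singular set \<open>drop_y\<close> inverts \<open>fold_point\<close>, so
    subtracting \<open>h (drop_y p)\<close> is what makes \<open>P\<close> vanish there.\<close>
  define P where "P p = u p $ CZ - p $ CZ * u p $ CY - h (drop_y p)" for p
  have "K_regular_at (\<lambda>p. h (drop_y p)) 0"
    using K_regular_at_compose[of h drop_y 0] by (simp add: h K_regular_at_drop_y)
  then have "K_regular_at P 0"
    unfolding P_def by (intro K_regular_at_intros u')
  moreover have "\<forall>\<^sub>F q in nhds 0. P (fold_point q) = 0"
    using eq by (auto simp: P_def fold_point_nth elim!: eventually_mono)
  ultimately obtain Q where Q: "K_regular_at Q 0"
    "\<forall>\<^sub>F p in nhds 0. P p = (3 * (p $ CZ)\<^sup>2 + p $ CY) * Q p"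
    by (rule divide_by_fold)
  show ?thesis
  proof
    \<comment> \<open>The differential preserves the x and y components, which are therefore copied
      from \<open>u\<close>; it multiplies the z component by 3z^2 + y, so the quotient
      \<open>Q\<close> goes there.\<close>
    show "map_regular_at (\<lambda>p. point (x_part (u p)) (u p $ CY) (Q p)) 0"
      unfolding map_regular_at_iff
      by (intro allI K_regular_at_point Q(1) u') (simp add: x_part_def u')
    show "\<forall>\<^sub>F p in nhds 0. u p = frechet_derivative cuspidal_map (at p)
        (point (x_part (u p)) (u p $ CY) (Q p)) + point 0 0 (h (drop_y p))"
      using Q(2)
    proof eventually_elim
      case (elim p)
      then have "u p $ CZ = p $ CZ * u p $ CY + (3 * (p $ CZ)\<^sup>2 + p $ CY) * Q p + h (drop_y p)"
        by (simp add: P_def algebra_simps)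
      then show ?case
        by (simp add: frechet_derivative_cuspidal_map vec_eq_iff all_coord x_part_def)
    qed
  qed
qed

text \<open>A linear choice of a field with prescribed remainder \<open>h\<close>: zero on
  \<open>F\<close>, and on the cuspidal branch the normal form obtained by division.\<close>

definition cusp_section :: "('k^'m option \<Rightarrow> 'k) \<Rightarrow> 'i + 'k^'m coord \<Rightarrow> 'k^'m coord \<Rightarrow> 'k^'m coord" where
  "cusp_section h = case_sum (\<lambda>_ _. 0) (\<lambda>_ p. point 0 0 (h (drop_y p)))"

lemma map_regular_at_section:
  "K_regular_at h 0 \<Longrightarrow> map_regular_at (\<lambda>p :: 'k^'m coord. point 0 0 (h (drop_y p))) 0"
  using K_regular_at_compose[of h drop_y 0] unfolding map_regular_at_iff
  by (intro allI K_regular_at_point) (simp_all add: K_regular_at_drop_y K_regular_at_const)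

lemma isCont_fold_point: "isCont (fold_point :: 'k^'m option \<Rightarrow> _) a"
  by (rule continuous_vecI, rule K_regular_at_continuous, rule K_regular_at_fold_point)

text \<open>Being zero on \<open>F\<close> forces the target field \<open>\<eta>\<close> to be
  cancelled there by a source field, so \<open>\<eta>\<close> is liftable; on the cuspidal branch,
  restriction to the singular set then computes \<open>h\<close> from \<open>\<eta>\<close>.
  Conversely, a liftable \<open>\<eta>\<close> is cancelled on \<open>F\<close> by the negative of
  its lift, and division provides the source field on the cuspidal branch.\<close>

lemma cusp_section_in_tangent_space_iff:
  fixes F :: "('i, 'k, 'm coord, 'm coord) multigerm"
  assumes F: "is_multigerm F" and h: "h \<in> function_germs"
  shows "cusp_section h \<in> extended_tangent_space (join_germs F cuspidal_germ) \<longleftrightarrow>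
    h \<in> cuspidal_subspace F"
proof
  assume "cusp_section h \<in> extended_tangent_space (join_germs F cuspidal_germ)"
  then obtain \<xi> \<zeta> \<eta> where *: "\<xi> \<in> theta_source F" "map_regular_at \<zeta> 0" "\<eta> \<in> theta_target"
      "\<And>i. i \<in> branches F \<Longrightarrow> \<forall>\<^sub>F x in nhds (base_point F i).
        0 = frechet_derivative (branch_map F i) (at x) (\<xi> i x) + \<eta> (branch_map F i x)"
      "\<forall>\<^sub>F p in nhds 0.
        point 0 0 (h (drop_y p)) = frechet_derivative cuspidal_map (at p) (\<zeta> p) + \<eta> (cuspidal_map p)"
    unfolding extended_tangent_space_join_cuspidal_iff cusp_section_def by auto
  have "\<eta> \<in> Lift F"
    unfolding Lift_def
  proof (intro CollectI conjI *(3) bexI[of _ "\<lambda>i x. 0 + (-1) *s \<xi> i x"] ballI)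
    fix i assume i: "i \<in> branches F"
    have "map_regular_at (branch_map F i) (base_point F i)"
      using F i unfolding is_multigerm_def by blast
    from linear_frechet_derivative_near[OF this] *(4)[OF i]
    show "\<forall>\<^sub>F x in nhds (base_point F i).
       frechet_derivative (branch_map F i) (at x) (0 + (-1) *s \<xi> i x) = \<eta> (branch_map F i x)"
    proof eventually_elim
      case (elim x)
      from elim(1)[rule_format, of 0 1 0] elim(1)[rule_format, of 0 "-1" "\<xi> i x"] elim(2)
      show ?case by (simp add: add_eq_0_iff)
    qed
  qed (use *(1) in \<open>simp_all add: theta_source_def map_regular_at_uminus\<close>)
  moreover have "\<forall>\<^sub>F q in nhds 0. point 0 0 (h (drop_y (fold_point q))) =
      frechet_derivative cuspidal_map (at (fold_point q)) (\<zeta> (fold_point q)) + \<eta> (cuspidal_map (fold_point q))"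
    by (rule eventually_nhds_compose[where \<phi> = fold_point and b = 0, OF _ isCont_fold_point fold_point_0])
      (rule *(5))
  then have "\<forall>\<^sub>F q in nhds 0. h q = cuspidal_restriction \<eta> q"
  proof eventually_elim
    case (elim q)
    \<comment> \<open>The z component of \<open>\<zeta>\<close> has the coefficient 3z^2 + y = 0
      here and drops out. Solving the first equation for the y component and inserting it in the
      second gives the restriction.\<close>
    then have "0 = \<zeta> (fold_point q) $ CY + \<eta> (cuspidal_map (fold_point q)) $ CY"
      "h q = q $ None * \<zeta> (fold_point q) $ CY + \<eta> (cuspidal_map (fold_point q)) $ CZ"
      unfolding frechet_derivative_cuspidal_map vec_eq_iff all_coord
      by (simp_all add: fold_point_nth)
    then show ?case
      unfolding cuspidal_restriction_eq by (simp add: add_eq_0_iff2)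
  qed
  ultimately show "h \<in> cuspidal_subspace F"
    using h unfolding cuspidal_subspace_def by blast
next
  assume "h \<in> cuspidal_subspace F"
  then obtain \<eta> where \<eta>: "\<eta> \<in> Lift F" and eq: "\<forall>\<^sub>F q in nhds 0. h q = cuspidal_restriction \<eta> q"
    unfolding cuspidal_subspace_def by blast
  from \<eta> obtain \<xi> where *: "\<eta> \<in> theta_target" "\<xi> \<in> theta_source F"
    "\<And>i. i \<in> branches F \<Longrightarrow> \<forall>\<^sub>F x in nhds (base_point F i).
          frechet_derivative (branch_map F i) (at x) (\<xi> i x) = \<eta> (branch_map F i x)"
    unfolding Lift_def by blast
  have \<eta>0: "map_regular_at \<eta> 0" using *(1) by (simp add: theta_target_def)
  have h0: "K_regular_at h 0" using h by (simp add: function_germs_iff)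
  have "map_regular_at (\<lambda>p. \<eta> (cuspidal_map p)) 0"
    by (rule map_regular_at_compose) (simp_all add: \<eta>0 map_regular_at_cuspidal_map)
  then have reg: "map_regular_at (\<lambda>p. - \<eta> (cuspidal_map p)) 0"
    by (rule map_regular_at_uminus)
  \<comment> \<open>The source field wanted on the cuspidal branch must have the image
    \<open>(0, 0, h) - \<eta> \<circ> cuspidal_map\<close>; so the field to divide is
    \<open>- \<eta> \<circ> cuspidal_map\<close>, with remainder \<open>- h\<close>.\<close>
  have "\<forall>\<^sub>F q in nhds 0. - h q = (- \<eta> (cuspidal_map (fold_point q))) $ CZ -
      q $ None * (- \<eta> (cuspidal_map (fold_point q))) $ CY"
    using eq by eventually_elim (simp add: cuspidal_restriction_eq)
  with reg K_regular_at_uminus[OF h0] obtain \<zeta> where \<zeta>: "map_regular_at \<zeta> 0"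
    "\<forall>\<^sub>F p in nhds 0. - \<eta> (cuspidal_map p) =
       frechet_derivative cuspidal_map (at p) (\<zeta> p) + point 0 0 (- h (drop_y p))"
    by (rule cuspidal_division)
  show "cusp_section h \<in> extended_tangent_space (join_germs F cuspidal_germ)"
    unfolding extended_tangent_space_join_cuspidal_iff
  proof (intro conjI bexI[of _ "\<lambda>i x. 0 + (-1) *s \<xi> i x"] exI[of _ \<zeta>] \<zeta>(1) bexI[of _ \<eta>] ballI *(1))
    show "cusp_section h \<in> theta (join_germs F cuspidal_germ)"
      unfolding theta_join_cuspidal_iff cusp_section_def
      using map_regular_at_section[OF h0] by (simp add: theta_def map_regular_at_zero)
  next
    fix i assume i: "i \<in> branches F"
    have "map_regular_at (branch_map F i) (base_point F i)"
      using F i unfolding is_multigerm_def by blast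
    from linear_frechet_derivative_near[OF this] *(3)[OF i]
    show "\<forall>\<^sub>F x in nhds (base_point F i). cusp_section h (Inl i) x =
       frechet_derivative (branch_map F i) (at x) (0 + (-1) *s \<xi> i x) + \<eta> (branch_map F i x)"
    proof eventually_elim
      case (elim x)
      from elim(1)[rule_format, of 0 1 0] elim(1)[rule_format, of 0 "-1" "\<xi> i x"] elim(2)
      show ?case by (simp add: cusp_section_def)
    qed
  next
    show "\<forall>\<^sub>F p in nhds 0. cusp_section h (Inr 0) p =
       frechet_derivative cuspidal_map (at p) (\<zeta> p) + \<eta> (cuspidal_map p)"
      using \<zeta>(2)
    proof eventually_elim
      case (elim p)
      have "point 0 0 (- h (drop_y p)) = (- point 0 0 (h (drop_y p)) :: 'k^'m coord)"
        by (simp add: point_eq_iff)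
      with elim show ?case
        by (simp add: cusp_section_def algebra_simps)
    qed
  qed (use *(2) in \<open>simp_all add: theta_source_def map_regular_at_uminus\<close>)
qed

text \<open>Stability solves the equation on \<open>F\<close> with some \<open>\<xi>\<close> and
  \<open>\<eta>\<close>. The same \<open>\<eta>\<close> is then imposed on the cuspidal branch,
  where the rest is reduced by division.\<close>

lemma ex_cusp_section:
  fixes F :: "('i, 'k, 'm coord, 'm coord) multigerm"
  assumes stable: "stable F" and v: "v \<in> theta (join_germs F cuspidal_germ)"
  shows "\<exists>h\<in>function_germs.
    (\<lambda>i x. v i x + (-1) *s cusp_section h i x) \<in> extended_tangent_space (join_germs F cuspidal_germ)"
proof -
  have v1: "(\<lambda>i. v (Inl i)) \<in> theta F" and v2: "map_regular_at (v (Inr 0)) 0"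
    using v by (simp_all add: theta_join_cuspidal_iff)
  have "(\<lambda>i. v (Inl i)) \<in> extended_tangent_space F"
    using quotient_dim_eq_0 stable v1 unfolding stable_def Ae_cod_def by blast
  then obtain \<xi> \<eta> where *: "\<xi> \<in> theta_source F" "\<eta> \<in> theta_target"
    "\<And>i. i \<in> branches F \<Longrightarrow> \<forall>\<^sub>F x in nhds (base_point F i).
      v (Inl i) x = frechet_derivative (branch_map F i) (at x) (\<xi> i x) + \<eta> (branch_map F i x)"
    unfolding extended_tangent_space_def by blast
  \<comment> \<open>What remains on the cuspidal branch after the contribution of the target field
    already fixed by \<open>F\<close>.\<close>
  define u where "u p = v (Inr 0) p + (-1) *s \<eta> (cuspidal_map p)" for p
  have "map_regular_at (\<lambda>p. \<eta> (cuspidal_map p)) 0"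
    by (rule map_regular_at_compose)
      (use *(2) in \<open>simp_all add: theta_target_def map_regular_at_cuspidal_map\<close>)
  then have u: "map_regular_at u 0"
    unfolding u_def by (intro map_regular_at_add map_regular_at_smult v2)
  define h where "h q = u (fold_point q) $ CZ - q $ None * u (fold_point q) $ CY" for q
  have "K_regular_at (\<lambda>q. u (fold_point q) $ j) 0" for j
    using u K_regular_at_compose[of "\<lambda>p. u p $ j" fold_point 0]
    by (simp add: map_regular_at_iff K_regular_at_fold_point)
  then have h: "K_regular_at h 0"
    unfolding h_def by (intro K_regular_at_intros)
  obtain \<zeta> where \<zeta>: "map_regular_at \<zeta> 0"
    "\<forall>\<^sub>F p in nhds 0. u p = frechet_derivative cuspidal_map (at p) (\<zeta> p) + point 0 0 (h (drop_y p))"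
    using cuspidal_division[OF u h] h_def by auto
  show ?thesis
  proof (intro bexI[of _ h])
    show "h \<in> function_germs" using h by (simp add: function_germs_iff)
    show "(\<lambda>i x. v i x + (-1) *s cusp_section h i x) \<in> extended_tangent_space (join_germs F cuspidal_germ)"
      unfolding extended_tangent_space_join_cuspidal_iff
    proof (intro conjI bexI[OF _ *(1)] exI[of _ \<zeta>] \<zeta>(1) bexI[OF _ *(2)] ballI)
      show "(\<lambda>i x. v i x + (-1) *s cusp_section h i x) \<in> theta (join_germs F cuspidal_germ)"
        unfolding theta_join_cuspidal_iff cusp_section_def
        using v1 map_regular_at_add[OF v2 map_regular_at_smult[OF map_regular_at_section[OF h], of "-1"]]
        by simp
    next
      fix i assume "i \<in> branches F"
      from *(3)[OF this]
      show "\<forall>\<^sub>F x in nhds (base_point F i). v (Inl i) x + (-1) *s cusp_section h (Inl i) x =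
         frechet_derivative (branch_map F i) (at x) (\<xi> i x) + \<eta> (branch_map F i x)"
        by (simp add: cusp_section_def)
    next
      show "\<forall>\<^sub>F p in nhds 0. v (Inr 0) p + (-1) *s cusp_section h (Inr 0) p =
         frechet_derivative cuspidal_map (at p) (\<zeta> p) + \<eta> (cuspidal_map p)"
        using \<zeta>(2) by eventually_elim (simp add: cusp_section_def u_def algebra_simps)
    qed
  qed
qed

lemma Ae_cod_join_cuspidal:
  fixes F :: "('i, 'k, 'm coord, 'm coord) multigerm"
  assumes F: "is_multigerm F" and stable: "stable F"
  shows "Ae_cod (join_germs F cuspidal_germ) =
    quotient_dim (\<lambda>c \<xi> q. c * \<xi> q) function_germs (cuspidal_subspace F)"
proof -
  let ?G = "join_germs F cuspidal_germ" and ?L = "cusp_section :: _ \<Rightarrow> 'i + 'k^'m coord \<Rightarrow> _"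
  let ?T = "extended_tangent_space ?G"
  note lin = extended_tangent_space_add_smult[OF is_multigerm_join_cuspidal[OF F]]
  note zero = zero_in_extended_tangent_space[OF is_multigerm_join_cuspidal[OF F]]
  have L_add: "?L (h + h') i x = ?L h i x + ?L h' i x" for h h' i x
    by (cases i) (simp_all add: cusp_section_def point_eq_iff)
  have L_smult: "?L (\<lambda>q. c * h q) i x = c *s ?L h i x" for c h i x
    by (cases i) (simp_all add: cusp_section_def point_eq_iff)
  have L_zero: "?L 0 i x = 0" for i x
    by (cases i) (simp_all add: cusp_section_def point_eq_iff)
  have zero_germ: "(0 :: 'k^'m option \<Rightarrow> 'k) \<in> function_germs"
    by (simp add: function_germs_iff K_regular_at_const zero_fun_def)
  \<comment> \<open>\<open>v\<close> is related to every \<open>h\<close> for which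
    \<open>cusp_section h\<close> is congruent to \<open>v\<close> modulo the tangent space.\<close>
  define R where "R v h \<longleftrightarrow> h \<in> function_germs \<and> (\<lambda>i x. v i x + (-1) *s ?L h i x) \<in> ?T" for v h
  show ?thesis
    unfolding Ae_cod_def
  proof (rule quotient_dim_eqI[where R = R, OF module_theta module_function_germs])
    show "R 0 0"
      using zero zero_germ by (simp add: R_def L_zero)
  next
    fix v h v' h' assume "R v h" "R v' h'"
    then have "h + h' \<in> function_germs"
      and "(\<lambda>i x. (v i x + (-1) *s ?L h i x) + 1 *s (v' i x + (-1) *s ?L h' i x)) \<in> ?T"
      unfolding R_def using lin by (simp_all only: function_germs_iff plus_fun_def K_regular_at_add)
    then show "R (v + v') (h + h')"
      by (simp add: R_def L_add algebra_simps)
  next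
    fix c v h assume "R v h"
    then have "(\<lambda>q. c * h q) \<in> function_germs"
      and "(\<lambda>i x. 0 + c *s (v i x + (-1) *s ?L h i x)) \<in> ?T"
      unfolding R_def using lin[OF zero]
      by (simp_all only: function_germs_iff K_regular_at_mult K_regular_at_const)
    then show "R (\<lambda>i x. c *s v i x) (\<lambda>q. c * h q)"
      by (simp add: R_def L_smult vector_add_ldistrib vector_smult_assoc)
  next
    show "\<exists>h\<in>function_germs. R v h" if "v \<in> theta ?G" for v
      using ex_cusp_section[OF stable that] by (auto simp: R_def)
  next
    fix h :: "'k^'m option \<Rightarrow> 'k" assume h: "h \<in> function_germs"
    then have "?L h \<in> theta ?G"
      unfolding theta_join_cuspidal_iff
      by (simp add: cusp_section_def theta_def map_regular_at_zero map_regular_at_section function_germs_iff)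
    moreover have "R (?L h) h"
      using h zero by (simp add: R_def)
    ultimately show "\<exists>v\<in>theta ?G. R v h" by blast
  next
    fix v h assume "R v h"
    then have h: "h \<in> function_germs" and d: "(\<lambda>i x. v i x + (-1) *s ?L h i x) \<in> ?T"
      by (auto simp: R_def)
    \<comment> \<open>The two differ by an element of the tangent space, which is added or
      subtracted.\<close>
    have "v \<in> ?T \<longleftrightarrow> ?L h \<in> ?T"
      using lin[OF _ d, of v "-1"] lin[OF d, of "?L h" 1] by (auto simp: algebra_simps)
    then show "v \<in> ?T \<longleftrightarrow> h \<in> cuspidal_subspace F"
      by (simp only: cusp_section_in_tangent_space_iff[OF F h])
  next
    have "?L 0 = (\<lambda>i x. 0)" by (intro ext L_zero)
    then have "?L 0 \<in> ?T" using zero by (simp only:)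
    then show "0 \<in> cuspidal_subspace F"
      by (simp only: cusp_section_in_tangent_space_iff[OF F zero_germ])
  qed
qed

end

interpretation real_germs: K_regular_germs "TYPE('m::finite)" "TYPE(real)"
  by unfold_locales (rule regular_at_real_iff)+

interpretation complex_germs: K_regular_germs "TYPE('m::finite)" "TYPE(complex)"
  by unfold_locales (rule regular_at_complex_iff)+

theorem theorem4p12:
  "(\<forall>(S :: (real^'m::finite) set) f fl F.
      is_multigerm (germ_along S f) \<and> minimal_corank (germ_along S f) \<and>
      stable_unfolding S f fl F \<longrightarrow>
      Ae_cod (join_germs F cuspidal_germ) =
        quotient_dim (\<lambda>c \<xi> q. c * \<xi> q) function_germs (cuspidal_subspace F)) \<and>
   (\<forall>(S :: (complex^'m::finite) set) f fl F.
      is_multigerm (germ_along S f) \<and> minimal_corank (germ_along S f) \<and>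
      stable_unfolding S f fl F \<longrightarrow>
      Ae_cod (join_germs F cuspidal_germ) =
        quotient_dim (\<lambda>c \<xi> q. c * \<xi> q) function_germs (cuspidal_subspace F))"
  unfolding stable_unfolding_def
  using real_germs.Ae_cod_join_cuspidal complex_germs.Ae_cod_join_cuspidal by blast

end
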